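(* Let $a(\lambda)=\det A(\lambda)$ for $\lambda\in\mathbb{C}\setminus\mathbb{R}$, and let $n_-$ be the number of indices $k\in\{1,\dots,n\}$ with $\alpha_k<0$. (1) If $n_-=0$, then $a(\lambda)\neq0$ for all $\lambda\in\mathbb{C}_+$. (2) If $n_->0$ and $v_1,\dots,v_n$ are linearly independent, then the equation $a(\lambda)=0$ can have only a finite number of roots $\lambda_1,\dots,\lambda_m$ in $\mathbb{C}_+$, and they all lie on the imaginary axis: $\lambda_p=i\varkappa_p$ with $\varkappa_p>0$. The subspaces $L_p=\operatorname{Ker}A(\lambda_p)\subset\mathbb{C}^n$ ($1\le p\le m$) satisfy $L_p\cap L_q=\{0\}$ whenever $\lambda_p\neq\lambda_q$, and $$\sum_{p}\dim L_p\le n_-.$$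
   Context: Let $n\in\mathbb{N}$, let $\alpha_1,\dots,\alpha_n$ be non-zero real numbers, $\alpha=\operatorname{diag}(\alpha_1,\dots,\alpha_n)$, and let $v_1,\dots,v_n$ be complex-valued functions on $\mathbb{R}_+=(0,\infty)$ with $\int_{\mathbb{R}_+}(1+x^2)|v_k(x)|^2dx<\infty$ for all $k$. $\mathbb{C}_+$ is the open upper half-plane. For real $t$, $\widetilde v_k(t)=\int_{\mathbb{R}_+}e^{-itx}v_k(x)\,dx$ and $w_k(t)=\widetilde v_k(t)-\widetilde v_k(-t)$. Let $W^+(t)W(t)$ denote the $n\times n$ matrix whose entry in row $j$, column $k$ is $\overline{w_j(t)}\,w_k(t)$. For $\lambda\in\mathbb{C}\setminus\mathbb{R}$, $$A(\lambda)=\frac1{2\pi i}\int_{\mathbb{R}}\frac{W^+(t)W(t)}{t-\lambda}\,dt-2i\lambda\,\alpha^{-1}.$$ *)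

theory Defs
  imports "HOL-Analysis.Analysis"
begin

definition upper_half_plane :: "complex set" where
  "upper_half_plane = {z. Im z > 0}"

definition diag_mat :: "('n \<Rightarrow> real) \<Rightarrow> complex ^ 'n ^ 'n::finite" where
  "diag_mat \<alpha> = (\<chi> j k. if j = k then complex_of_real (\<alpha> j) else 0)"

definition half_line_fourier :: "(real \<Rightarrow> complex) \<Rightarrow> real \<Rightarrow> complex" where
  "half_line_fourier u t =
     (LINT x:{0<..}|lebesgue. exp (- (\<i> * complex_of_real t * complex_of_real x)) * u x)"

definition w_fun :: "('n \<Rightarrow> real \<Rightarrow> complex) \<Rightarrow> 'n \<Rightarrow> real \<Rightarrow> complex" where
  "w_fun v k t = half_line_fourier (v k) t - half_line_fourier (v k) (- t)"

definition WW :: "('n \<Rightarrow> real \<Rightarrow> complex) \<Rightarrow> real \<Rightarrow> complex ^ 'n ^ 'n::finite" where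
  "WW v t = (\<chi> j k. cnj (w_fun v j t) * w_fun v k t)"

(* The matrix-valued integral is taken entrywise.  Only non-real z is meaningful. *)
definition A_mat ::
  "('n \<Rightarrow> real) \<Rightarrow> ('n \<Rightarrow> real \<Rightarrow> complex) \<Rightarrow> complex \<Rightarrow> complex ^ 'n ^ 'n::finite" where
  "A_mat \<alpha> v z =
     (\<chi> j k. 1 / (2 * complex_of_real pi * \<i>) *
               (LINT t|lebesgue. (WW v t $ j $ k) / (complex_of_real t - z))
             - 2 * \<i> * z * (matrix_inv (diag_mat \<alpha>) $ j $ k))"

definition a_fun :: "('n::finite \<Rightarrow> real) \<Rightarrow> ('n \<Rightarrow> real \<Rightarrow> complex) \<Rightarrow> complex \<Rightarrow> complex" where
  "a_fun \<alpha> v z = det (A_mat \<alpha> v z)"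

definition roots_up :: "('n::finite \<Rightarrow> real) \<Rightarrow> ('n \<Rightarrow> real \<Rightarrow> complex) \<Rightarrow> complex set" where
  "roots_up \<alpha> v = {z \<in> upper_half_plane. a_fun \<alpha> v z = 0}"

definition ker_mat :: "complex ^ 'n ^ 'n::finite \<Rightarrow> (complex ^ 'n) set" where
  "ker_mat M = {x. M *v x = 0}"

definition n_minus :: "('n::finite \<Rightarrow> real) \<Rightarrow> nat" where
  "n_minus \<alpha> = card {k. \<alpha> k < 0}"

definition weighted_L2 :: "(real \<Rightarrow> complex) \<Rightarrow> bool" where
  "weighted_L2 u \<longleftrightarrow>
     set_borel_measurable lebesgue {0<..} u \<and>
     set_integrable lebesgue {0<..} (\<lambda>x. (1 + x\<^sup>2) * (cmod (u x))\<^sup>2)"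

(* Linear independence over the complex numbers of the classes in L2(0,oo):
   functions that agree almost everywhere are identified. *)
definition lin_indep_L2 :: "('n::finite \<Rightarrow> real \<Rightarrow> complex) \<Rightarrow> bool" where
  "lin_indep_L2 v \<longleftrightarrow>
     (\<forall>c :: 'n \<Rightarrow> complex.
        (AE x in lebesgue. x \<in> {0<..} \<longrightarrow> (\<Sum>k\<in>UNIV. c k * v k x) = 0) \<longrightarrow> (\<forall>k. c k = 0))"

end

theory Submission
  imports Defs "HOL-Probability.Characteristic_Functions" "HOL-Probability.Sinc_Integral"
begin

text \<open>
  Each \<open>w\<^sub>k\<close> is odd, so symmetrizing the Cauchy integral gives
  \<open>A(z) = - (\<i> z / 2 \<pi>) (\<integral> W\<^sup>+W / (t\<^sup>2 - z\<^sup>2) dt + 4 \<pi> \<alpha>\<^sup>-\<^sup>1)\<close>; the integral converges because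
  \<open>w\<^sub>k \<in> L\<^sup>2\<close> by Plancherel's inequality. If \<open>A(z) x = 0\<close>, the imaginary part of the quadratic form at
  \<open>x\<close> forces \<open>Re z = 0\<close>, unless \<open>W x = 0\<close> almost everywhere, which means \<open>\<alpha>\<^sup>-\<^sup>1 x = 0\<close>.
  For kernel vectors \<open>x\<^sub>p\<close> at distinct points \<open>\<i> \<kappa>\<^sub>p\<close>, the functions \<open>f\<^sub>p = W x\<^sub>p / (t\<^sup>2 + \<kappa>\<^sub>p\<^sup>2)\<close>
  are pairwise orthogonal, and the form of \<open>\<alpha>\<^sup>-\<^sup>1\<close> at \<open>\<Sum> x\<^sub>p\<close> equals
  \<open>- (1 / 4 \<pi>) (\<integral> t\<^sup>2 \<bar>\<Sum> f\<^sub>p\<bar>\<^sup>2 dt + \<Sum> \<kappa>\<^sub>p\<^sup>2 \<integral> \<bar>f\<^sub>p\<bar>\<^sup>2 dt)\<close>. So this form is negative definite on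
  the sum of the kernels, the sum is direct, and projecting it to the coordinates with
  \<open>\<alpha>\<^sub>k < 0\<close> is injective. This bounds the sum of the dimensions by \<open>n\<^sub>-\<close>, which in turn
  bounds the number of roots.
\<close>

section \<open>Plancherel's inequality\<close>

lemma integrable_lborel_pair_mult:
  fixes f g :: "real \<Rightarrow> complex"
  assumes f: "integrable lborel f" and g: "integrable lborel g"
  shows "integrable (lborel \<Otimes>\<^sub>M lborel) (\<lambda>p. f (fst p) * g (snd p))"
proof -
  have [measurable]: "f \<in> borel_measurable borel" "g \<in> borel_measurable borel"
    using f[THEN borel_measurable_integrable] g[THEN borel_measurable_integrable] by simp_all
  show ?thesis
  proof (rule lborel_pair.Fubini_integrable)
    show "(\<lambda>p. f (fst p) * g (snd p)) \<in> borel_measurable (lborel \<Otimes>\<^sub>M lborel)"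
      by measurable
    show "integrable lborel (\<lambda>x. LINT y|lborel. norm (f (fst (x, y)) * g (snd (x, y))))"
      using f by (simp add: norm_mult)
    show "AE x in lborel. integrable lborel (\<lambda>y. f (fst (x, y)) * g (snd (x, y)))"
      using g by simp
  qed
qed

lemma integral_lborel_pair_mult:
  fixes f g :: "real \<Rightarrow> complex"
  assumes f: "integrable lborel f" and g: "integrable lborel g"
  shows "(LINT p|(lborel \<Otimes>\<^sub>M lborel). f (fst p) * g (snd p)) = (LINT x|lborel. f x) * (LINT y|lborel. g y)"
proof -
  have "(LINT p|(lborel \<Otimes>\<^sub>M lborel). f (fst p) * g (snd p)) = (LINT x|lborel. LINT y|lborel. f x * g y)"
    using lborel_pair.integral_fst'[OF integrable_lborel_pair_mult[OF f g]] by simp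
  then show ?thesis using f g by simp
qed

lemma nn_integral_cmult_normal_density:
  "\<sigma> > 0 \<Longrightarrow> c \<ge> 0 \<Longrightarrow> (\<integral>\<^sup>+y. ennreal (c * normal_density x \<sigma> y) \<partial>lborel) = ennreal c"
  by (subst nn_integral_eq_integral) auto

lemma normal_density_commute: "normal_density x \<sigma> y = normal_density y \<sigma> x"
  by (simp add: normal_density_def power2_commute)

lemma integrable_exp_mult:
  fixes u :: "real \<Rightarrow> complex"
  assumes u: "integrable lborel u"
  shows "integrable lborel (\<lambda>x. exp (- (\<i> * complex_of_real t * complex_of_real x)) * u x)"
proof (rule Bochner_Integration.integrable_bound[OF u])
  have [measurable]: "u \<in> borel_measurable borel"
    using u[THEN borel_measurable_integrable] by simp
  show "(\<lambda>x. exp (- (\<i> * complex_of_real t * complex_of_real x)) * u x) \<in> borel_measurable lborel"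
    by measurable
qed (simp add: norm_mult)

text \<open>The Gaussian weight makes Fubini applicable: the squared modulus of \<open>F\<close>
  becomes a double integral in \<open>x\<close> and \<open>y\<close>, and integrating over
  \<open>s\<close> first produces the characteristic function of the normal law, that is, a Gaussian
  kernel in \<open>x - y\<close>. Its mass is the same in each variable, so it acts boundedly on
  square integrable functions.\<close>

lemma plancherel_ineq_gaussian:
  fixes u :: "real \<Rightarrow> complex"
  assumes u: "integrable lborel u" and u2: "integrable lborel (\<lambda>x. (cmod (u x))\<^sup>2)"
    and \<sigma>: "\<sigma> > 0"
  defines "F \<equiv> \<lambda>t. LINT x|lborel. exp (- (\<i> * complex_of_real t * complex_of_real x)) * u x"
  shows "(\<integral>\<^sup>+s. ennreal (std_normal_density s * (cmod (F (\<sigma> * s)))\<^sup>2) \<partial>lborel)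
    \<le> ennreal (sqrt (2 * pi) / \<sigma> * (LINT x|lborel. (cmod (u x))\<^sup>2))"
proof -
  have [measurable]: "u \<in> borel_measurable borel"
    using u[THEN borel_measurable_integrable] by simp
  have [measurable]: "F \<in> borel_measurable borel"
    unfolding F_def by (rule lborel.borel_measurable_lebesgue_integral) simp
  let ?N = "std_normal_distribution" and ?P = "lborel \<Otimes>\<^sub>M lborel :: (real \<times> real) measure"
  interpret N: prob_space ?N by (rule prob_space_normal_density) simp
  interpret PN: pair_sigma_finite ?P ?N
    by (intro pair_sigma_finite.intro sigma_finite_pair_measure sigma_finite_lborel N.sigma_finite_measure_axioms)
  define I where "I = (LINT x|lborel. (cmod (u x))\<^sup>2)"
  define C where "C = sqrt (2 * pi) / \<sigma>"
  have C: "C > 0" using \<sigma> by (simp add: C_def)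
  \<comment> \<open>The normal density with deviation \<open>1 / \<sigma>\<close> carries the factor
    \<open>\<sigma> / sqrt (2 * pi)\<close>. \<open>C\<close> is the inverse of that factor, hence
    the total mass of the kernel.\<close>
  have K: "exp (- (\<sigma> * (x - y))\<^sup>2 / 2) = C * normal_density x (1 / \<sigma>) y" for x y
    unfolding power_mult_distrib using \<sigma> by (simp add: normal_density_def C_def real_sqrt_mult real_sqrt_divide
        power_divide power2_commute[of x y])
  define U where "U p = u (fst p) * cnj (u (snd p))" for p
  have U: "integrable ?P U"
    unfolding U_def by (rule integrable_lborel_pair_mult) (use u in auto)
  have [measurable]: "U \<in> borel_measurable ?P"
    using U by (rule borel_measurable_integrable)
  define E where "E p s = exp (- (\<i> * complex_of_real (\<sigma> * s * (fst p - snd p))))" for p :: "real \<times> real" and s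
  have E1: "cmod (E p s) = 1" for p s by (simp add: E_def)
  have FF: "F (\<sigma> * s) * cnj (F (\<sigma> * s)) = (LINT p|?P. U p * E p s)" for s
  proof -
    let ?e = "\<lambda>x. exp (- (\<i> * complex_of_real (\<sigma> * s) * complex_of_real x)) * u x"
    have e: "integrable lborel ?e" by (rule integrable_exp_mult[OF u])
    have "F (\<sigma> * s) * cnj (F (\<sigma> * s)) = (LINT x|lborel. ?e x) * (LINT x|lborel. cnj (?e x))"
      unfolding F_def by (subst Bochner_Integration.integral_cnj) (rule refl)
    also have "\<dots> = (LINT p|?P. ?e (fst p) * cnj (?e (snd p)))"
      by (rule integral_lborel_pair_mult[symmetric, OF e integrable_cnj[OF e]])
    also have "\<dots> = (LINT p|?P. U p * E p s)"
    proof (rule Bochner_Integration.integral_cong[OF refl])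
      fix p :: "real \<times> real"
      have "E p s = exp (- (\<i> * complex_of_real (\<sigma> * s) * complex_of_real (fst p)))
          * cnj (exp (- (\<i> * complex_of_real (\<sigma> * s) * complex_of_real (snd p))))"
        by (simp add: E_def exp_cnj exp_add[symmetric] algebra_simps)
      then show "?e (fst p) * cnj (?e (snd p)) = U p * E p s"
        by (simp add: U_def)
    qed
    finally show ?thesis .
  qed
  \<comment> \<open>\<open>E\<close> has modulus one and the normal law has mass one, so
    integrability reduces to that of \<open>U\<close>.\<close>
  have intUE: "integrable (?P \<Otimes>\<^sub>M ?N) (\<lambda>(p, s). U p * E p s)"
  proof (rule Bochner_Integration.integrable_bound)
    show "integrable (?P \<Otimes>\<^sub>M ?N) (\<lambda>(p, s). U p)"
    proof (rule PN.Fubini_integrable)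
      show "integrable ?P (\<lambda>p. LINT s|?N. norm (case (p, s) of (p, s) \<Rightarrow> U p))"
        using U by simp
    qed auto
    show "(\<lambda>(p, s). U p * E p s) \<in> borel_measurable (?P \<Otimes>\<^sub>M ?N)"
      unfolding E_def by measurable
  qed (auto simp: norm_mult E1)
  have char: "(LINT s|?N. E p s) = complex_of_real (C * normal_density (fst p) (1 / \<sigma>) (snd p))" for p
  proof -
    have "(LINT s|?N. E p s) = char ?N (- \<sigma> * (fst p - snd p))"
      unfolding char_def E_def by (intro Bochner_Integration.integral_cong) (auto simp: algebra_simps)
    also have "\<dots> = complex_of_real (exp (- (\<sigma> * (fst p - snd p))\<^sup>2 / 2))"
      by (simp add: char_std_normal_distribution)
    finally show ?thesis unfolding K .
  qed
  have "(LINT s|?N. F (\<sigma> * s) * cnj (F (\<sigma> * s))) = (LINT p|?P. LINT s|?N. U p * E p s)"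
    unfolding FF by (rule PN.Fubini_integral[OF intUE])
  also have "\<dots> = (LINT p|?P. U p * complex_of_real (C * normal_density (fst p) (1 / \<sigma>) (snd p)))"
    by (simp add: char)
  finally have eq: "complex_of_real (LINT s|?N. (cmod (F (\<sigma> * s)))\<^sup>2)
      = (LINT p|?P. U p * complex_of_real (C * normal_density (fst p) (1 / \<sigma>) (snd p)))"
    by (simp only: complex_norm_square[symmetric] integral_complex_of_real)
  have "integrable ?N (\<lambda>s. F (\<sigma> * s) * cnj (F (\<sigma> * s)))"
    unfolding FF by (rule PN.integrable_snd[OF intUE])
  then have intF: "integrable ?N (\<lambda>s. (cmod (F (\<sigma> * s)))\<^sup>2)"
    by (simp only: complex_norm_square[symmetric] complex_of_real_integrable_eq)
  have "(\<integral>\<^sup>+s. ennreal (std_normal_density s * (cmod (F (\<sigma> * s)))\<^sup>2) \<partial>lborel)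
      = (\<integral>\<^sup>+s. ennreal ((cmod (F (\<sigma> * s)))\<^sup>2) \<partial>?N)"
    by (subst nn_integral_density) (auto simp: ennreal_mult)
  also have "\<dots> = ennreal (LINT s|?N. (cmod (F (\<sigma> * s)))\<^sup>2)"
    using intF by (rule nn_integral_eq_integral) simp
  also have "(LINT s|?N. (cmod (F (\<sigma> * s)))\<^sup>2)
      = cmod (LINT p|?P. U p * complex_of_real (C * normal_density (fst p) (1 / \<sigma>) (snd p)))"
    unfolding eq[symmetric] by simp
  also have "ennreal \<dots> \<le> (\<integral>\<^sup>+p. ennreal (cmod (U p * complex_of_real (C * normal_density (fst p) (1 / \<sigma>) (snd p)))) \<partial>?P)"
  proof (rule integral_norm_bound_ennreal, rule Bochner_Integration.integrable_bound)
    \<comment> \<open>\<open>?d\<close> is the maximum of the density, so a constant multiple of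
      \<open>U\<close> dominates the integrand.\<close>
    let ?d = "1 / sqrt (2 * pi * (1 / \<sigma>)\<^sup>2)"
    show "integrable ?P (\<lambda>p. complex_of_real (C * ?d) * U p)"
      using U by simp
    show "(\<lambda>p. U p * complex_of_real (C * normal_density (fst p) (1 / \<sigma>) (snd p))) \<in> borel_measurable ?P"
      unfolding normal_density_def by measurable
    have "cmod (U p * complex_of_real (C * normal_density (fst p) (1 / \<sigma>) (snd p)))
        \<le> cmod (complex_of_real (C * ?d) * U p)" for p
    proof -
      have "normal_density (fst p) (1 / \<sigma>) (snd p) \<le> ?d"
        unfolding normal_density_def by (rule mult_left_le) auto
      then have "cmod (U p) * (C * normal_density (fst p) (1 / \<sigma>) (snd p)) \<le> cmod (U p) * (C * ?d)"
        using C by (intro mult_left_mono) auto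
      moreover have "0 \<le> C * ?d" "0 \<le> C * normal_density (fst p) (1 / \<sigma>) (snd p)"
        using C by auto
      ultimately show ?thesis
        unfolding norm_mult norm_of_real by (metis abs_of_nonneg mult.commute)
    qed
    then show "AE p in ?P. cmod (U p * complex_of_real (C * normal_density (fst p) (1 / \<sigma>) (snd p)))
        \<le> cmod (complex_of_real (C * ?d) * U p)"
      by simp
  qed
  \<comment> \<open>Schur test: AM-GM splits the double integral into two, each with the kernel integrated out.\<close>
  also have "\<dots> \<le> (\<integral>\<^sup>+p. ennreal (C / 2 * (cmod (u (fst p)))\<^sup>2 * normal_density (fst p) (1 / \<sigma>) (snd p))
        + ennreal (C / 2 * (cmod (u (snd p)))\<^sup>2 * normal_density (snd p) (1 / \<sigma>) (fst p)) \<partial>?P)"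
  proof (rule nn_integral_mono)
    fix p :: "real \<times> real"
    let ?a = "cmod (u (fst p))" and ?b = "cmod (u (snd p))" and ?k = "normal_density (fst p) (1 / \<sigma>) (snd p)"
    have "?a * ?b \<le> (?a\<^sup>2 + ?b\<^sup>2) / 2"
      using sum_squares_bound[of ?a ?b] by simp
    then have "?a * ?b * (C * ?k) \<le> (?a\<^sup>2 + ?b\<^sup>2) / 2 * (C * ?k)"
      using C by (intro mult_right_mono) auto
    also have "\<dots> = C / 2 * ?a\<^sup>2 * ?k + C / 2 * ?b\<^sup>2 * ?k"
      by (simp add: field_simps)
    finally have "ennreal (?a * ?b * (C * ?k)) \<le> ennreal (C / 2 * ?a\<^sup>2 * ?k + C / 2 * ?b\<^sup>2 * ?k)"
      by (rule ennreal_leI)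
    also have "\<dots> = ennreal (C / 2 * ?a\<^sup>2 * ?k) + ennreal (C / 2 * ?b\<^sup>2 * ?k)"
      by (rule ennreal_plus) (use C in auto)
    finally show "ennreal (cmod (U p * complex_of_real (C * ?k)))
        \<le> ennreal (C / 2 * ?a\<^sup>2 * ?k) + ennreal (C / 2 * ?b\<^sup>2 * normal_density (snd p) (1 / \<sigma>) (fst p))"
      using C by (simp add: U_def norm_mult normal_density_commute[of "snd p"])
  qed
  also have "\<dots> = (\<integral>\<^sup>+p. ennreal (C / 2 * (cmod (u (fst p)))\<^sup>2 * normal_density (fst p) (1 / \<sigma>) (snd p)) \<partial>?P)
       + (\<integral>\<^sup>+p. ennreal (C / 2 * (cmod (u (snd p)))\<^sup>2 * normal_density (snd p) (1 / \<sigma>) (fst p)) \<partial>?P)"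
    unfolding normal_density_def by (rule nn_integral_add) auto
  also have "(\<integral>\<^sup>+p. ennreal (C / 2 * (cmod (u (fst p)))\<^sup>2 * normal_density (fst p) (1 / \<sigma>) (snd p)) \<partial>?P)
      = (\<integral>\<^sup>+x. ennreal (C / 2 * (cmod (u x))\<^sup>2) \<partial>lborel)"
  proof -
    have "(\<integral>\<^sup>+p. ennreal (C / 2 * (cmod (u (fst p)))\<^sup>2 * normal_density (fst p) (1 / \<sigma>) (snd p)) \<partial>?P)
      = (\<integral>\<^sup>+x. \<integral>\<^sup>+y. ennreal (C / 2 * (cmod (u x))\<^sup>2 * normal_density x (1 / \<sigma>) y) \<partial>lborel \<partial>lborel)"
      unfolding normal_density_def by (subst lborel.nn_integral_fst[symmetric]) auto
    also have "\<dots> = (\<integral>\<^sup>+x. ennreal (C / 2 * (cmod (u x))\<^sup>2) \<partial>lborel)"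
      using C \<sigma> by (intro nn_integral_cong) (rule nn_integral_cmult_normal_density, auto)
    finally show ?thesis .
  qed
  \<comment> \<open>Now the second coordinate stays fixed in the outer integral. The arguments of
    the density were swapped in this summand so that it again integrates to one.\<close>
  also have "(\<integral>\<^sup>+p. ennreal (C / 2 * (cmod (u (snd p)))\<^sup>2 * normal_density (snd p) (1 / \<sigma>) (fst p)) \<partial>?P)
      = (\<integral>\<^sup>+x. ennreal (C / 2 * (cmod (u x))\<^sup>2) \<partial>lborel)"
  proof -
    have "(\<integral>\<^sup>+p. ennreal (C / 2 * (cmod (u (snd p)))\<^sup>2 * normal_density (snd p) (1 / \<sigma>) (fst p)) \<partial>?P)
      = (\<integral>\<^sup>+x. \<integral>\<^sup>+y. ennreal (C / 2 * (cmod (u x))\<^sup>2 * normal_density x (1 / \<sigma>) y) \<partial>lborel \<partial>lborel)"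
      unfolding normal_density_def by (subst lborel_pair.nn_integral_snd[symmetric]) auto
    also have "\<dots> = (\<integral>\<^sup>+x. ennreal (C / 2 * (cmod (u x))\<^sup>2) \<partial>lborel)"
      using C \<sigma> by (intro nn_integral_cong) (rule nn_integral_cmult_normal_density, auto)
    finally show ?thesis .
  qed
  also have "(\<integral>\<^sup>+x. ennreal (C / 2 * (cmod (u x))\<^sup>2) \<partial>lborel) = ennreal (C / 2 * I)"
    unfolding I_def using u2 C by (subst nn_integral_eq_integral) auto
  also have "ennreal (C / 2 * I) + ennreal (C / 2 * I) = ennreal (C * I)"
    using C by (subst ennreal_plus[symmetric]) (auto simp: I_def)
  finally show ?thesis unfolding C_def I_def .
qed

text \<open>After rescaling, the Gaussian version bounds the integral of the squared modulus of
  \<open>F\<close> against a weight that tends to one, uniformly in the width of the weight. Fatou's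
  lemma removes the weight.\<close>

lemma plancherel_ineq:
  fixes u :: "real \<Rightarrow> complex"
  assumes u: "integrable lborel u" and u2: "integrable lborel (\<lambda>x. (cmod (u x))\<^sup>2)"
  defines "F \<equiv> \<lambda>t. LINT x|lborel. exp (- (\<i> * complex_of_real t * complex_of_real x)) * u x"
  shows "(\<integral>\<^sup>+t. ennreal ((cmod (F t))\<^sup>2) \<partial>lborel) \<le> ennreal (2 * pi * (LINT x|lborel. (cmod (u x))\<^sup>2))"
proof -
  have [measurable]: "u \<in> borel_measurable borel"
    using u[THEN borel_measurable_integrable] by simp
  have [measurable]: "F \<in> borel_measurable borel"
    unfolding F_def by (rule lborel.borel_measurable_lebesgue_integral) simp
  define I where "I = (LINT x|lborel. (cmod (u x))\<^sup>2)"
  \<comment> \<open>\<open>Suc n\<close> takes the place of \<open>\<sigma>\<close>, which must be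
    positive.\<close>
  define G where "G n t = exp (- (t / real (Suc n))\<^sup>2 / 2) * (cmod (F t))\<^sup>2" for n t
  have bound: "(\<integral>\<^sup>+t. ennreal (G n t) \<partial>lborel) \<le> ennreal (2 * pi * I)" for n
  proof -
    define \<sigma> where "\<sigma> = real (Suc n)"
    have \<sigma>: "\<sigma> > 0" by (simp add: \<sigma>_def)
    have "(\<integral>\<^sup>+t. ennreal (G n t) \<partial>lborel)
        = (\<integral>\<^sup>+t. ennreal (sqrt (2 * pi)) * ennreal (std_normal_density (t / \<sigma>) * (cmod (F t))\<^sup>2) \<partial>lborel)"
      by (intro nn_integral_cong)
         (simp add: G_def \<sigma>_def std_normal_density_def ennreal_mult[symmetric])
    also have "\<dots> = ennreal (sqrt (2 * pi)) * (\<integral>\<^sup>+t. ennreal (std_normal_density (t / \<sigma>) * (cmod (F t))\<^sup>2) \<partial>lborel)"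
      by (rule nn_integral_cmult) measurable
    \<comment> \<open>Substitution \<open>t = \<sigma> * s\<close>: the Jacobian
      \<open>\<sigma>\<close> cancels the \<open>1 / \<sigma>\<close> of the Gaussian bound.\<close>
    also have "(\<integral>\<^sup>+t. ennreal (std_normal_density (t / \<sigma>) * (cmod (F t))\<^sup>2) \<partial>lborel)
        = ennreal \<sigma> * (\<integral>\<^sup>+s. ennreal (std_normal_density s * (cmod (F (\<sigma> * s)))\<^sup>2) \<partial>lborel)"
      using \<sigma> by (subst nn_integral_real_affine[where c=\<sigma> and t=0]) auto
    also have "\<dots> \<le> ennreal \<sigma> * ennreal (sqrt (2 * pi) / \<sigma> * I)"
      unfolding I_def F_def by (intro mult_left_mono plancherel_ineq_gaussian u u2 \<sigma>) auto
    also have "ennreal (sqrt (2 * pi)) * \<dots> = ennreal (2 * pi * I)"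
    proof -
      have "I \<ge> 0" by (simp add: I_def)
      then have "ennreal (sqrt (2 * pi)) * (ennreal \<sigma> * ennreal (sqrt (2 * pi) / \<sigma> * I))
          = ennreal (sqrt (2 * pi) * (\<sigma> * (sqrt (2 * pi) / \<sigma> * I)))"
        using \<sigma> by (simp only: ennreal_mult[symmetric] real_sqrt_ge_0_iff divide_nonneg_pos mult_nonneg_nonneg
            less_imp_le pi_ge_zero zero_le_numeral)
      also have "sqrt (2 * pi) * (\<sigma> * (sqrt (2 * pi) / \<sigma> * I)) = 2 * pi * I"
        using \<sigma> by simp
      finally show ?thesis .
    qed
    finally show ?thesis by (simp add: mult_left_mono)
  qed
  have lim: "(\<lambda>n. ennreal (G n t)) \<longlonglongrightarrow> ennreal ((cmod (F t))\<^sup>2)" for t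
  proof -
    have "(\<lambda>n. t / real (Suc n)) \<longlonglongrightarrow> 0"
      using LIMSEQ_Suc[OF lim_const_over_n[of t]] by simp
    then have "(\<lambda>n. G n t) \<longlonglongrightarrow> exp (- 0\<^sup>2 / 2) * (cmod (F t))\<^sup>2"
      unfolding G_def by (intro tendsto_intros) auto
    then show ?thesis by (intro tendsto_ennrealI) simp
  qed
  have "(\<integral>\<^sup>+t. ennreal ((cmod (F t))\<^sup>2) \<partial>lborel) = (\<integral>\<^sup>+t. liminf (\<lambda>n. ennreal (G n t)) \<partial>lborel)"
    using lim by (intro nn_integral_cong lim_imp_Liminf[symmetric]) auto
  also have "\<dots> \<le> liminf (\<lambda>n. \<integral>\<^sup>+t. ennreal (G n t) \<partial>lborel)"
    unfolding G_def by (rule nn_integral_liminf) measurable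
  also have "\<dots> \<le> ennreal (2 * pi * I)"
    using bound by (intro Liminf_le) auto
  finally show ?thesis unfolding I_def .
qed

section \<open>Square integrability of the transforms \<open>w_fun\<close>\<close>

lemma completion_ex_borel_measurable_complex:
  fixes f :: "'a \<Rightarrow> complex"
  assumes f: "f \<in> borel_measurable (completion M)"
  shows "\<exists>g\<in>borel_measurable M. AE x in M. f x = g x"
proof -
  have "(\<lambda>x. Re (f x)) \<in> borel_measurable (completion M)" "(\<lambda>x. Im (f x)) \<in> borel_measurable (completion M)"
    using f by auto
  then obtain a b where [measurable]: "a \<in> borel_measurable M" "b \<in> borel_measurable M"
    and ab: "AE x in M. Re (f x) = a x" "AE x in M. Im (f x) = b x"
    using completion_ex_borel_measurable_real by metis
  have "(\<lambda>x. Complex (a x) (b x)) \<in> borel_measurable M"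
    by (simp add: borel_measurable_complex_iff)
  moreover have "AE x in M. f x = Complex (a x) (b x)"
    using ab by eventually_elim (simp add: complex_eq_iff)
  ultimately show ?thesis by (intro bexI[where x="\<lambda>x. Complex (a x) (b x)"])
qed

text \<open>The weight makes \<open>v\<close> both integrable and square integrable on the
  half-line, so its transform converges absolutely and Plancherel's inequality applies. A Borel
  function equal to \<open>v\<close> almost everywhere carries the integrals from
  \<open>lebesgue\<close> to \<open>lborel\<close>, where Fubini was used.\<close>

lemma weighted_L2_half_line_fourier:
  assumes v: "weighted_L2 v"
  shows "half_line_fourier v \<in> borel_measurable borel"
    and "integrable lborel (\<lambda>t. (cmod (half_line_fourier v t))\<^sup>2)"
proof -
  \<comment> \<open>Extension by zero turns the half-line transform into one over the whole
    line.\<close>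
  define f where "f x = indicat_real {0<..} x *\<^sub>R v x" for x :: real
  have f: "f \<in> borel_measurable lebesgue"
    using v unfolding weighted_L2_def set_borel_measurable_def f_def by simp
  then obtain u where u [measurable]: "u \<in> borel_measurable lborel" and fu: "AE x in lborel. f x = u x"
    using completion_ex_borel_measurable_complex[of f lborel] by auto
  have fu': "AE x in lebesgue. f x = u x"
    using fu by (rule AE_completion)
  have u': "u \<in> borel_measurable lebesgue"
    using u by (rule measurable_completion)
  have eu: "(\<lambda>x. exp (- (\<i> * complex_of_real t * complex_of_real x)) * u x) \<in> borel_measurable lborel" for t
    by measurable
  have m2: "(\<lambda>x. (1 + x\<^sup>2) * (cmod (g x))\<^sup>2) \<in> borel_measurable lebesgue"
    and me: "(\<lambda>x. exp (- (\<i> * complex_of_real t * complex_of_real x)) * g x) \<in> borel_measurable lebesgue"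
    if [measurable]: "g \<in> borel_measurable lebesgue" for g :: "real \<Rightarrow> complex" and t
  proof -
    have [measurable]: "(\<lambda>x. x) \<in> borel_measurable (lebesgue :: real measure)"
      by (rule measurable_completion) simp
    show "(\<lambda>x. (1 + x\<^sup>2) * (cmod (g x))\<^sup>2) \<in> borel_measurable lebesgue"
      "(\<lambda>x. exp (- (\<i> * complex_of_real t * complex_of_real x)) * g x) \<in> borel_measurable lebesgue"
      by measurable
  qed
  have "integrable lebesgue (\<lambda>x. (1 + x\<^sup>2) * (cmod (f x))\<^sup>2)"
    using v unfolding weighted_L2_def set_integrable_def f_def
    by (auto elim!: Bochner_Integration.integrable_cong[THEN iffD1, rotated -1] simp: indicator_def)
  then have "integrable lebesgue (\<lambda>x. (1 + x\<^sup>2) * (cmod (u x))\<^sup>2)"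
    using fu' by (subst integrable_cong_AE[where g="\<lambda>x. (1 + x\<^sup>2) * (cmod (f x))\<^sup>2"]) (auto intro: m2 u' f)
  then have wu: "integrable lborel (\<lambda>x. (1 + x\<^sup>2) * (cmod (u x))\<^sup>2)"
    by (subst (asm) integrable_completion) auto
  have u2: "integrable lborel (\<lambda>x. (cmod (u x))\<^sup>2)"
    by (rule Bochner_Integration.integrable_bound[OF wu]) (auto simp: mult_ge1_I algebra_simps)
  have inv: "integrable lborel (\<lambda>x::real. inverse (1 + x\<^sup>2))"
    using integrable_inverse_1_plus_square by (simp add: set_integrable_def)
  \<comment> \<open>AM-GM: \<open>2 \<bar>u\<bar> \<le> (1 + x\<^sup>2) \<bar>u\<bar>\<^sup>2 + 1 / (1 + x\<^sup>2)\<close>\<close>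
  have "integrable lborel (\<lambda>x. (1 + x\<^sup>2) * (cmod (u x))\<^sup>2 + inverse (1 + x\<^sup>2))"
    by (intro Bochner_Integration.integrable_add wu inv)
  then have u1: "integrable lborel u"
  proof (rule Bochner_Integration.integrable_bound)
    show "AE x in lborel. norm (u x) \<le> norm ((1 + x\<^sup>2) * (cmod (u x))\<^sup>2 + inverse (1 + x\<^sup>2))"
    proof (rule AE_I2)
      fix x :: real
      define s where "s = sqrt (1 + x\<^sup>2)"
      have s: "s > 0" "s\<^sup>2 = 1 + x\<^sup>2" by (auto simp: s_def add_pos_nonneg)
      have "2 * cmod (u x) = 2 * (s * cmod (u x)) * inverse s"
        using s by simp
      also have "\<dots> \<le> (s * cmod (u x))\<^sup>2 + (inverse s)\<^sup>2"
        by (rule sum_squares_bound)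
      also have "\<dots> = (1 + x\<^sup>2) * (cmod (u x))\<^sup>2 + inverse (1 + x\<^sup>2)"
        by (simp add: power_mult_distrib power_inverse s(2))
      finally have "2 * cmod (u x) \<le> (1 + x\<^sup>2) * (cmod (u x))\<^sup>2 + inverse (1 + x\<^sup>2)" .
      moreover have "0 \<le> (1 + x\<^sup>2) * (cmod (u x))\<^sup>2 + inverse (1 + x\<^sup>2)" by simp
      ultimately show "norm (u x) \<le> norm ((1 + x\<^sup>2) * (cmod (u x))\<^sup>2 + inverse (1 + x\<^sup>2))"
        unfolding real_norm_def using norm_ge_zero[of "u x"] by linarith
    qed
  qed simp
  have hf: "half_line_fourier v = (\<lambda>t. LINT x|lborel. exp (- (\<i> * complex_of_real t * complex_of_real x)) * u x)"
  proof
    fix t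
    have "half_line_fourier v t = (LINT x|lebesgue. exp (- (\<i> * complex_of_real t * complex_of_real x)) * f x)"
      unfolding half_line_fourier_def set_lebesgue_integral_def f_def
      by (intro Bochner_Integration.integral_cong) auto
    also have "\<dots> = (LINT x|lebesgue. exp (- (\<i> * complex_of_real t * complex_of_real x)) * u x)"
      using fu' by (intro integral_cong_AE me u' f) auto
    also have "\<dots> = (LINT x|lborel. exp (- (\<i> * complex_of_real t * complex_of_real x)) * u x)"
      by (rule integral_completion[OF eu])
    finally show "half_line_fourier v t = \<dots>" .
  qed
  show meas [measurable]: "half_line_fourier v \<in> borel_measurable borel"
    unfolding hf by (rule lborel.borel_measurable_lebesgue_integral) simp
  show "integrable lborel (\<lambda>t. (cmod (half_line_fourier v t))\<^sup>2)"
  proof (rule integrableI_bounded)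
    have "(\<integral>\<^sup>+t. ennreal ((cmod (half_line_fourier v t))\<^sup>2) \<partial>lborel)
        \<le> ennreal (2 * pi * (LINT x|lborel. (cmod (u x))\<^sup>2))"
      unfolding hf by (rule plancherel_ineq[OF u1 u2])
    then show "(\<integral>\<^sup>+t. ennreal (norm ((cmod (half_line_fourier v t))\<^sup>2)) \<partial>lborel) < \<infinity>"
      by (simp add: le_less_trans)
  qed measurable
qed

lemma integrable_cmod_diff_power2:
  fixes f g :: "'a \<Rightarrow> complex"
  assumes [measurable]: "f \<in> borel_measurable M" "g \<in> borel_measurable M"
    and f: "integrable M (\<lambda>t. (cmod (f t))\<^sup>2)" and g: "integrable M (\<lambda>t. (cmod (g t))\<^sup>2)"
  shows "integrable M (\<lambda>t. (cmod (f t - g t))\<^sup>2)"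
proof (rule Bochner_Integration.integrable_bound)
  show "integrable M (\<lambda>t. 2 * (cmod (f t))\<^sup>2 + 2 * (cmod (g t))\<^sup>2)"
    using f g by simp
  have "(cmod (f t - g t))\<^sup>2 \<le> 2 * (cmod (f t))\<^sup>2 + 2 * (cmod (g t))\<^sup>2" for t
  proof -
    have "(cmod (f t - g t))\<^sup>2 \<le> (cmod (f t) + cmod (g t))\<^sup>2"
      by (intro power_mono norm_triangle_ineq4) auto
    then show ?thesis
      using sum_squares_bound[of "cmod (f t)" "cmod (g t)"] by (simp add: power2_sum)
  qed
  then show "AE t in M. norm ((cmod (f t - g t))\<^sup>2) \<le> norm (2 * (cmod (f t))\<^sup>2 + 2 * (cmod (g t))\<^sup>2)"
    by simp
qed measurable

lemma weighted_L2_w_fun: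
  assumes v: "weighted_L2 (v k)"
  shows "w_fun v k \<in> borel_measurable borel" and "integrable lborel (\<lambda>t. (cmod (w_fun v k t))\<^sup>2)"
proof -
  note h [measurable] = weighted_L2_half_line_fourier(1)[OF v] and h2 = weighted_L2_half_line_fourier(2)[OF v]
  have *: "w_fun v k = (\<lambda>t. half_line_fourier (v k) t - half_line_fourier (v k) (- t))"
    by (simp add: w_fun_def fun_eq_iff)
  show "w_fun v k \<in> borel_measurable borel"
    unfolding * by measurable
  have "integrable lborel (\<lambda>t. (cmod (half_line_fourier (v k) (- t)))\<^sup>2)"
    using lborel_integrable_real_affine[OF h2, of "- 1" 0] by simp
  then show "integrable lborel (\<lambda>t. (cmod (w_fun v k t))\<^sup>2)"
    unfolding * by (intro integrable_cmod_diff_power2 h2) measurable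
qed

section \<open>Linear algebra\<close>

lemma matrix_inv_unique:
  fixes A :: "'a::field ^ 'n ^ 'n"
  assumes "A ** B = mat 1" "B ** A = mat 1"
  shows "matrix_inv A = B"
proof -
  have "A ** matrix_inv A = mat 1 \<and> matrix_inv A ** A = mat 1"
    unfolding matrix_inv_def by (rule someI[of _ B]) (use assms in auto)
  then show ?thesis
    by (metis assms(2) matrix_mul_assoc matrix_mul_lid matrix_mul_rid)
qed

lemma matrix_inv_diag_mat:
  fixes \<alpha> :: "'n::finite \<Rightarrow> real"
  assumes "\<And>k. \<alpha> k \<noteq> 0"
  shows "matrix_inv (diag_mat \<alpha>) = diag_mat (\<lambda>k. 1 / \<alpha> k)"
proof -
  have *: "diag_mat \<beta> ** diag_mat \<gamma> = diag_mat (\<lambda>k. \<beta> k * \<gamma> k)" for \<beta> \<gamma> :: "'n \<Rightarrow> real"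
  proof -
    have "(\<Sum>k\<in>UNIV. (if i = k then complex_of_real (\<beta> i) else 0) * (if k = j then complex_of_real (\<gamma> k) else 0))
        = (\<Sum>k\<in>UNIV. if i = k then complex_of_real (\<beta> i) * (if i = j then complex_of_real (\<gamma> i) else 0) else 0)" for i j
      by (rule sum.cong) auto
    then show ?thesis
      by (simp add: diag_mat_def matrix_matrix_mult_def vec_eq_iff)
  qed
  have "diag_mat \<alpha> ** diag_mat (\<lambda>k. 1 / \<alpha> k) = mat 1" "diag_mat (\<lambda>k. 1 / \<alpha> k) ** diag_mat \<alpha> = mat 1"
    using assms by (simp_all add: *) (simp_all add: diag_mat_def mat_def vec_eq_iff)
  then show ?thesis
    by (rule matrix_inv_unique)
qed

text \<open>Induction on \<open>F\<close>: independence makes the new subspace meet the sum of the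
  others only in zero, so the dimension formula for a sum of two subspaces has no correction
  term.\<close>

lemma dim_sum_independent_subspaces:
  fixes K :: "'i \<Rightarrow> ('a::field ^ 'n) set"
  assumes "finite F" and "\<And>i. i \<in> F \<Longrightarrow> vec.subspace (K i)"
    and "\<And>x. (\<And>i. i \<in> F \<Longrightarrow> x i \<in> K i) \<Longrightarrow> (\<Sum>i\<in>F. x i) = 0 \<Longrightarrow> \<forall>i\<in>F. x i = 0"
  shows "vec.subspace {\<Sum>i\<in>F. x i | x. \<forall>i\<in>F. x i \<in> K i} \<and>
    vec.dim {\<Sum>i\<in>F. x i | x. \<forall>i\<in>F. x i \<in> K i} = (\<Sum>i\<in>F. vec.dim (K i))"
  using assms
proof (induction F)
  case empty
  then show ?case by simp
next
  case (insert j F)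
  let ?S = "\<lambda>F. {\<Sum>i\<in>F. x i | x. \<forall>i\<in>F. x i \<in> K i}"
  \<comment> \<open>A relation over \<open>F\<close> becomes one over \<open>insert j F\<close> by
    putting zero at \<open>j\<close>.\<close>
  have ind: "\<forall>i\<in>F. x i = 0" if "\<And>i. i \<in> F \<Longrightarrow> x i \<in> K i" "(\<Sum>i\<in>F. x i) = 0" for x
  proof -
    have "0 \<in> K j" using insert.prems(1)[of j] vec.subspace_0 by auto
    moreover have "(\<Sum>i\<in>F. (x(j := 0)) i) = (\<Sum>i\<in>F. x i)"
      using insert.hyps by (intro sum.cong) auto
    ultimately have "\<forall>i\<in>insert j F. (x(j := 0)) i = 0"
      using that insert.hyps by (intro insert.prems(2)) auto
    then show ?thesis using insert.hyps by (metis fun_upd_other insertI2)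
  qed
  have "vec.subspace (?S F) \<and> vec.dim (?S F) = (\<Sum>i\<in>F. vec.dim (K i))"
  proof (rule insert.IH)
    show "vec.subspace (K i)" if "i \<in> F" for i
      using insert.prems(1) that by simp
  qed (rule ind)
  then have IH: "vec.subspace (?S F)" "vec.dim (?S F) = (\<Sum>i\<in>F. vec.dim (K i))"
    by (simp_all only: simp_thms)
  have Kj: "vec.subspace (K j)" using insert.prems(1) by simp
  have eq: "?S (insert j F) = {a + b | a b. a \<in> K j \<and> b \<in> ?S F}"
  proof (intro equalityI subsetI)
    fix y assume "y \<in> ?S (insert j F)"
    then obtain x where "y = (\<Sum>i\<in>insert j F. x i)" "\<forall>i\<in>insert j F. x i \<in> K i" by blast
    then show "y \<in> {a + b | a b. a \<in> K j \<and> b \<in> ?S F}"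
      using insert.hyps by auto
  next
    fix y assume "y \<in> {a + b | a b. a \<in> K j \<and> b \<in> ?S F}"
    then obtain a x where "a \<in> K j" "\<forall>i\<in>F. x i \<in> K i" "y = a + (\<Sum>i\<in>F. x i)" by blast
    moreover have "(\<Sum>i\<in>F. (x(j := a)) i) = (\<Sum>i\<in>F. x i)"
      using insert.hyps by (intro sum.cong) auto
    ultimately have "y = (\<Sum>i\<in>insert j F. (x(j := a)) i)" "\<forall>i\<in>insert j F. (x(j := a)) i \<in> K i"
      using insert.hyps by auto
    then show "y \<in> ?S (insert j F)" by blast
  qed
  have "K j \<inter> ?S F \<subseteq> {0}"
  proof
    fix y assume "y \<in> K j \<inter> ?S F"
    then obtain x where x: "y \<in> K j" "y = (\<Sum>i\<in>F. x i)" "\<forall>i\<in>F. x i \<in> K i" by blast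
    \<comment> \<open>A common vector \<open>y\<close> of \<open>K j\<close> and the sum over
      \<open>F\<close> gives a relation with \<open>- y\<close> at \<open>j\<close>.\<close>
    have "(\<Sum>i\<in>F. (x(j := - y)) i) = (\<Sum>i\<in>F. x i)"
      using insert.hyps by (intro sum.cong) auto
    then have "\<forall>i\<in>insert j F. (x(j := - y)) i = 0"
      using x insert.hyps vec.subspace_neg[OF Kj] by (intro insert.prems(2)) auto
    then show "y \<in> {0}" by simp
  qed
  then have "vec.dim (K j \<inter> ?S F) = 0"
    by (rule vec.dim_eq_0[THEN iffD2])
  then have dim: "vec.dim {a + b | a b. a \<in> K j \<and> b \<in> ?S F} = vec.dim (K j) + (\<Sum>i\<in>F. vec.dim (K i))"
    using vec.dim_sums_Int[OF Kj IH(1)] IH(2) by linarith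
  show ?case
  proof
    show "vec.subspace (?S (insert j F))"
      unfolding eq by (rule vec.subspace_sums[OF Kj IH(1)])
    show "vec.dim (?S (insert j F)) = (\<Sum>i\<in>insert j F. vec.dim (K i))"
      unfolding eq dim using insert.hyps by simp
  qed
qed

text \<open>The hypothesis \<open>ind\<close> is stronger than independence: it also says that no
  nonzero vector of the sum vanishes on all coordinates in \<open>N\<close>. So the sum is direct
  and the projection \<open>P\<close> to those coordinates is injective on it.\<close>

lemma sum_dim_le_card_coordinates:
  fixes K :: "'i \<Rightarrow> ('a::field ^ 'n) set"
  assumes F: "finite F" and K: "\<And>i. i \<in> F \<Longrightarrow> vec.subspace (K i)"
    and ind: "\<And>x. (\<And>i. i \<in> F \<Longrightarrow> x i \<in> K i) \<Longrightarrow> (\<forall>k\<in>N. (\<Sum>i\<in>F. x i) $ k = 0) \<Longrightarrow> \<forall>i\<in>F. x i = 0"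
  shows "(\<Sum>i\<in>F. vec.dim (K i)) \<le> card N"
proof -
  define S where "S = {\<Sum>i\<in>F. x i | x. \<forall>i\<in>F. x i \<in> K i}"
  define P where "P x = (\<chi> k. if k \<in> N then x $ k else 0)" for x :: "'a ^ 'n"
  have S: "vec.subspace S" "vec.dim S = (\<Sum>i\<in>F. vec.dim (K i))"
    unfolding S_def using dim_sum_independent_subspaces[of F K] F K ind by (metis (no_types, lifting) zero_index)+
  have P: "Vector_Spaces.linear (*s) (*s) P"
    by unfold_locales (auto simp: P_def vec_eq_iff)
  have "inj_on P S"
  proof (rule vec.linear_inj_on_iff_eq_0[OF P S(1), THEN iffD2], intro ballI impI)
    fix y assume "y \<in> S" and 0: "P y = 0"
    then obtain x where x: "\<forall>i\<in>F. x i \<in> K i" "y = (\<Sum>i\<in>F. x i)" unfolding S_def by blast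
    have "y $ k = 0" if "k \<in> N" for k
      using arg_cong[OF 0, of "\<lambda>z. z $ k"] that by (simp add: P_def)
    then have "\<forall>i\<in>F. x i = 0" using x by (intro ind) auto
    then show "y = 0" using x by simp
  qed
  moreover have "vec.span S = S"
    using S(1) by (rule vec.span_eq_iff[THEN iffD2])
  ultimately have "vec.dim S = vec.dim (P ` S)"
    using vec.dim_image_eq[OF P, of S] by metis
  also have "\<dots> \<le> card ((\<lambda>k. axis k (1::'a)) ` N)"
  proof (rule vec.dim_le_card)
    show "P ` S \<subseteq> vec.span ((\<lambda>k. axis k 1) ` N)"
    proof
      fix z assume "z \<in> P ` S"
      then obtain y where "z = P y" by blast
      then have "z = (\<Sum>k\<in>N. y $ k *s axis k 1)"
        by (auto simp: P_def vec_eq_iff axis_def if_distrib cong: if_cong)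
      then show "z \<in> vec.span ((\<lambda>k. axis k 1) ` N)"
        by (simp only:, intro vec.span_sum vec.span_scale vec.span_base imageI)
    qed
  qed simp
  also have "\<dots> \<le> card N" by (rule card_image_le) simp
  finally show ?thesis using S(2) by simp
qed

lemma det_eq_0_iff_kernel: "det (A :: 'a::field ^ 'n ^ 'n) = 0 \<longleftrightarrow> (\<exists>x. x \<noteq> 0 \<and> A *v x = 0)"
  using invertible_det_nz[of A] matrix_left_invertible_ker[of A] invertible_left_inverse[of A] by metis

section \<open>The quadratic form of the matrix function\<close>

text \<open>Average the integral with its reflection under \<open>t\<close> to \<open>- t\<close>,
  using \<open>1 / (t - z) - 1 / (t + z) = 2 * z / (t^2 - z^2)\<close>.\<close>

lemma cauchy_integral_even:
  fixes F :: "real \<Rightarrow> complex"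
  assumes F: "integrable lborel F" and even: "\<And>t. F (- t) = F t" and z: "Im z \<noteq> 0"
  shows "(LINT t|lborel. F t / (complex_of_real t - z))
    = z * (LINT t|lborel. F t / ((complex_of_real t)\<^sup>2 - z\<^sup>2))"
proof -
  have [measurable]: "F \<in> borel_measurable borel"
    using F[THEN borel_measurable_integrable] by simp
  have bd: "cmod (1 / (complex_of_real t - w)) \<le> 1 / \<bar>Im w\<bar>" if "Im w \<noteq> 0" for t w
    using abs_Im_le_cmod[of "complex_of_real t - w"] that
    by (simp add: norm_divide frac_le)
  \<comment> \<open>Splitting the averaged integral requires integrability at both \<open>z\<close>
    and \<open>- z\<close>, hence a general non-real \<open>w\<close>.\<close>
  have int: "integrable lborel (\<lambda>t. F t / (complex_of_real t - w))" if w: "Im w \<noteq> 0" for w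
  proof (rule Bochner_Integration.integrable_bound)
    show "integrable lborel (\<lambda>t. complex_of_real (1 / \<bar>Im w\<bar>) * F t)"
      using F by simp
    show "AE t in lborel. cmod (F t / (complex_of_real t - w)) \<le> cmod (complex_of_real (1 / \<bar>Im w\<bar>) * F t)"
    proof (rule AE_I2)
      fix t
      have "cmod (F t / (complex_of_real t - w)) = cmod (F t) * cmod (1 / (complex_of_real t - w))"
        by (simp add: norm_divide)
      also have "\<dots> \<le> cmod (F t) * (1 / \<bar>Im w\<bar>)"
        by (intro mult_left_mono bd w) simp
      finally show "cmod (F t / (complex_of_real t - w)) \<le> cmod (complex_of_real (1 / \<bar>Im w\<bar>) * F t)"
        by (simp add: norm_divide norm_mult)
    qed
  qed measurable
  have "(LINT t|lborel. F t / (complex_of_real t - z)) = (LINT t|lborel. F (- t) / (complex_of_real (- t) - z))"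
    using lborel_integral_real_affine[of "- 1" "\<lambda>t. F t / (complex_of_real t - z)" 0] by simp
  also have "\<dots> = (LINT t|lborel. - (F t / (complex_of_real t - (- z))))"
  proof (rule Bochner_Integration.integral_cong[OF refl])
    show "F (- t) / (complex_of_real (- t) - z) = - (F t / (complex_of_real t - (- z)))" for t
      using minus_divide_right[of "F t" "complex_of_real t - (- z)"] by (simp add: even)
  qed
  finally have "2 * (LINT t|lborel. F t / (complex_of_real t - z))
      = (LINT t|lborel. F t / (complex_of_real t - z)) + (LINT t|lborel. - (F t / (complex_of_real t - (- z))))"
    by simp
  also have "\<dots> = (LINT t|lborel. F t / (complex_of_real t - z) + - (F t / (complex_of_real t - (- z))))"
    using int[of z] int[of "- z"] z by (intro Bochner_Integration.integral_add[symmetric] integrable_minus) auto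
  also have "\<dots> = (LINT t|lborel. 2 * z * (F t / ((complex_of_real t)\<^sup>2 - z\<^sup>2)))"
  proof (rule Bochner_Integration.integral_cong[OF refl])
    fix t
    have nz: "complex_of_real t - z \<noteq> 0" "complex_of_real t + z \<noteq> 0"
      using z by (auto simp: complex_eq_iff)
    have "(complex_of_real t)\<^sup>2 - z\<^sup>2 = (complex_of_real t - z) * (complex_of_real t + z)"
      by (simp add: power2_eq_square algebra_simps)
    then show "F t / (complex_of_real t - z) + - (F t / (complex_of_real t - (- z)))
        = 2 * z * (F t / ((complex_of_real t)\<^sup>2 - z\<^sup>2))"
      using nz by (simp add: divide_simps) (simp add: algebra_simps)
  qed
  also have "\<dots> = 2 * (z * (LINT t|lborel. F t / ((complex_of_real t)\<^sup>2 - z\<^sup>2)))"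
    by (subst integral_mult_right_zero) (rule mult.assoc)
  finally show ?thesis by (simp only: mult_left_cancel zero_neq_numeral[symmetric] not_False_eq_True)
qed

lemma borel_measurable_cnj [measurable (raw)]:
  fixes f :: "'a \<Rightarrow> complex"
  shows "f \<in> borel_measurable M \<Longrightarrow> (\<lambda>x. cnj (f x)) \<in> borel_measurable M"
  by (simp add: borel_measurable_complex_iff)

section \<open>Sesquilinear forms of an odd square integrable family\<close>

locale odd_L2_family =
  fixes w :: "'n::finite \<Rightarrow> real \<Rightarrow> complex" and \<alpha> :: "'n \<Rightarrow> real"
  assumes w_meas [measurable]: "\<And>k. w k \<in> borel_measurable borel"
    and w_L2: "\<And>k. integrable lborel (\<lambda>t. (cmod (w k t))\<^sup>2)"
    and w_odd: "\<And>k t. w k (- t) = - w k t"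
    and \<alpha>_nz: "\<And>k. \<alpha> k \<noteq> 0"
begin

text \<open>The row vector \<open>W(t)\<close> applied to \<open>x\<close>. Since the matrix
  integrand has rank one, its form at \<open>y\<close> and \<open>x\<close> is
  \<open>cnj (W y t) * W x t\<close>.\<close>

definition W :: "complex ^ 'n \<Rightarrow> real \<Rightarrow> complex" where
  "W x t = (\<Sum>k\<in>UNIV. w k t * x $ k)"

text \<open>The sesquilinear form of the matrix integral with scalar weight \<open>h\<close>,
  conjugate linear in \<open>y\<close>.\<close>

definition E :: "(real \<Rightarrow> complex) \<Rightarrow> complex ^ 'n \<Rightarrow> complex ^ 'n \<Rightarrow> complex" where
  "E h y x = (LINT t|lborel. cnj (W y t) * W x t * h t)"

lemma W_meas [measurable]: "W x \<in> borel_measurable borel"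
  unfolding W_def by measurable

lemma integrable_ww: "integrable lborel (\<lambda>t. cnj (w j t) * w k t)"
proof (rule Bochner_Integration.integrable_bound)
  show "integrable lborel (\<lambda>t. (cmod (w j t))\<^sup>2 + (cmod (w k t))\<^sup>2)"
    by (intro Bochner_Integration.integrable_add w_L2)
  have "cmod (w j t) * cmod (w k t) \<le> (cmod (w j t))\<^sup>2 + (cmod (w k t))\<^sup>2" for t
    using sum_squares_bound[of "cmod (w j t)" "cmod (w k t)"]
      mult_nonneg_nonneg[OF norm_ge_zero[of "w j t"] norm_ge_zero[of "w k t"]] by linarith
  then show "AE t in lborel. norm (cnj (w j t) * w k t) \<le> norm ((cmod (w j t))\<^sup>2 + (cmod (w k t))\<^sup>2)"
    by (simp add: norm_mult)
qed measurable

lemma WW_expand: "cnj (W y t) * W x t = (\<Sum>j\<in>UNIV. \<Sum>k\<in>UNIV. cnj (y $ j) * x $ k * (cnj (w j t) * w k t))"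
  unfolding W_def cnj_sum sum_product by (intro sum.cong refl) simp

lemma integrable_WW: "integrable lborel (\<lambda>t. cnj (W y t) * W x t)"
  unfolding WW_expand
  by (intro Bochner_Integration.integrable_sum integrable_mult_right integrable_ww)

lemma integrable_bounded_mult:
  fixes f h :: "real \<Rightarrow> complex"
  assumes f: "integrable lborel f" and [measurable]: "h \<in> borel_measurable borel" and C: "\<And>t. cmod (h t) \<le> C"
  shows "integrable lborel (\<lambda>t. f t * h t)"
proof (rule Bochner_Integration.integrable_bound)
  have [measurable]: "f \<in> borel_measurable borel"
    using f[THEN borel_measurable_integrable] by simp
  show "integrable lborel (\<lambda>t. complex_of_real C * f t)"
    using f by simp
  have "C \<ge> 0" using norm_ge_zero C by (rule order_trans)
  then have "cmod (f t * h t) \<le> cmod (complex_of_real C * f t)" for t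
    using mult_left_mono[OF C[of t], of "cmod (f t)"] by (simp add: norm_mult mult.commute)
  then show "AE t in lborel. cmod (f t * h t) \<le> cmod (complex_of_real C * f t)" by simp
  show "(\<lambda>t. f t * h t) \<in> borel_measurable lborel" by measurable
qed

lemma E_linear_h:
  assumes "g \<in> borel_measurable borel" "\<And>t. cmod (g t) \<le> C"
    and "h \<in> borel_measurable borel" "\<And>t. cmod (h t) \<le> D"
  shows "E (\<lambda>t. a * g t + b * h t) y x = a * E g y x + b * E h y x"
proof -
  have "integrable lborel (\<lambda>t. cnj (W y t) * W x t * g t)" "integrable lborel (\<lambda>t. cnj (W y t) * W x t * h t)"
    by (rule integrable_bounded_mult[OF integrable_WW]; fact)+
  then show ?thesis
    unfolding E_def by (simp add: distrib_left mult.left_commute[of _ a] mult.left_commute[of _ b])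
qed

lemma E_cnj: "cnj (E h y x) = E (\<lambda>t. cnj (h t)) x y"
  unfolding E_def by (subst Bochner_Integration.integral_cnj[symmetric]) (simp add: mult_ac)

lemma E_diagonal:
  assumes "h \<in> borel_measurable borel" "\<And>t. \<bar>h t\<bar> \<le> C"
  shows "E (\<lambda>t. complex_of_real (h t)) x x = complex_of_real (LINT t|lborel. (cmod (W x t))\<^sup>2 * h t)"
    and "integrable lborel (\<lambda>t. (cmod (W x t))\<^sup>2 * h t)"
proof -
  have eq: "cnj (W x t) * W x t * complex_of_real (h t) = complex_of_real ((cmod (W x t))\<^sup>2 * h t)" for t
    by (simp only: of_real_mult complex_norm_square) (simp add: mult_ac)
  show "E (\<lambda>t. complex_of_real (h t)) x x = complex_of_real (LINT t|lborel. (cmod (W x t))\<^sup>2 * h t)"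
    unfolding E_def eq by (rule integral_complex_of_real)
  have "integrable lborel (\<lambda>t. cnj (W x t) * W x t * complex_of_real (h t))"
    by (rule integrable_bounded_mult[OF integrable_WW, where C=C]) (use assms in auto)
  then show "integrable lborel (\<lambda>t. (cmod (W x t))\<^sup>2 * h t)"
    unfolding eq by (simp only: complex_of_real_integrable_eq)
qed

lemma AE_W_eq_0:
  assumes "h \<in> borel_measurable borel" "\<And>t. \<bar>h t\<bar> \<le> C" and pos: "\<And>t. h t > 0"
    and 0: "(LINT t|lborel. (cmod (W x t))\<^sup>2 * h t) = 0"
  shows "AE t in lborel. W x t = 0"
proof -
  have "AE t in lborel. (cmod (W x t))\<^sup>2 * h t = 0"
    using integral_nonneg_eq_0_iff_AE[OF E_diagonal(2)[OF assms(1,2), of x]] pos 0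
    by (simp add: less_imp_le)
  then show ?thesis
  proof eventually_elim
    case (elim t)
    then show ?case using pos[of t] by simp
  qed
qed

section \<open>The form \<open>Q\<close> of the inverse of \<open>diag_mat \<alpha>\<close>, and
  kernel vectors\<close>

definition Q :: "complex ^ 'n \<Rightarrow> complex ^ 'n \<Rightarrow> complex" where
  "Q y x = (\<Sum>j\<in>UNIV. cnj (y $ j) * x $ j / complex_of_real (\<alpha> j))"

text \<open>The kernel left over when the Cauchy kernel is symmetrized, without its factor
  \<open>z\<close>.\<close>

definition h :: "complex \<Rightarrow> real \<Rightarrow> complex" where
  "h z t = 1 / ((complex_of_real t)\<^sup>2 - z\<^sup>2)"

text \<open>For \<open>Im z > 0\<close>, pairing \<open>A(z) x = 0\<close> with an arbitrary \<open>y\<close> and dividing by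
  \<open>- \<i> z / (2 \<pi>)\<close> gives this identity.\<close>

definition kernel_vector :: "complex \<Rightarrow> complex ^ 'n \<Rightarrow> bool" where
  "kernel_vector z x \<longleftrightarrow> (\<forall>y. E (h z) y x = - complex_of_real (4 * pi) * Q y x)"

lemma h_meas [measurable]: "h z \<in> borel_measurable borel"
  unfolding h_def by measurable

text \<open>The denominator factors as \<open>(t - z) * (t + z)\<close>, and each factor has modulus
  at least \<open>\<bar>Im z\<bar>\<close>.\<close>

lemma norm_h_le:
  assumes z: "Im z \<noteq> 0"
  shows "cmod (h z t) \<le> 1 / (Im z)\<^sup>2"
proof -
  have "(Im z)\<^sup>2 \<le> cmod (complex_of_real t - z) * cmod (complex_of_real t + z)"
    using mult_mono[OF abs_Im_le_cmod[of "complex_of_real t - z"] abs_Im_le_cmod[of "complex_of_real t + z"]]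
    by (simp add: power2_eq_square)
  also have "\<dots> = cmod ((complex_of_real t)\<^sup>2 - z\<^sup>2)"
    unfolding norm_mult[symmetric] by (simp add: power2_eq_square algebra_simps)
  finally show ?thesis
    using z by (simp add: h_def norm_divide frac_le)
qed

lemma Q_cnj: "cnj (Q y x) = Q x y"
  by (simp add: Q_def mult.commute)

lemma Q_sum: "Q (\<Sum>q\<in>F. x q) (\<Sum>p\<in>G. y p) = (\<Sum>q\<in>F. \<Sum>p\<in>G. Q (x q) (y p))"
proof -
  have "Q (\<Sum>q\<in>F. x q) (\<Sum>p\<in>G. y p)
      = (\<Sum>j\<in>UNIV. \<Sum>q\<in>F. \<Sum>p\<in>G. cnj (x q $ j) * y p $ j / complex_of_real (\<alpha> j))"
    by (simp add: Q_def sum_product sum_divide_distrib)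
  also have "\<dots> = (\<Sum>q\<in>F. \<Sum>j\<in>UNIV. \<Sum>p\<in>G. cnj (x q $ j) * y p $ j / complex_of_real (\<alpha> j))"
    by (rule sum.swap)
  also have "\<dots> = (\<Sum>q\<in>F. \<Sum>p\<in>G. Q (x q) (y p))"
    unfolding Q_def by (intro sum.cong refl sum.swap)
  finally show ?thesis .
qed

lemma Q_self: "Q x x = complex_of_real (\<Sum>j\<in>UNIV. (cmod (x $ j))\<^sup>2 / \<alpha> j)"
proof -
  have "cnj (x $ j) * x $ j / complex_of_real (\<alpha> j) = complex_of_real ((cmod (x $ j))\<^sup>2 / \<alpha> j)" for j
    by (simp only: of_real_divide complex_norm_square) (simp add: mult_ac)
  then show ?thesis by (simp only: Q_def of_real_sum)
qed

text \<open>If \<open>W x\<close> vanishes almost everywhere, so does the left side of the kernel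
  identity. Testing \<open>Q\<close> with the unit vectors then gives
  \<open>x $ j / \<alpha> j = 0\<close> for each \<open>j\<close>.\<close>

lemma kernel_vector_eq_0:
  assumes x: "kernel_vector z x" and W: "AE t in lborel. W x t = 0"
  shows "x = 0"
proof -
  have "E (h z) y x = (LINT t|(lborel :: real measure). 0)" for y
    unfolding E_def by (rule integral_cong_AE, measurable) (use W in auto)
  then have "Q y x = 0" for y
    using x by (simp add: kernel_vector_def)
  then have "Q (axis j 1) x = 0" for j .
  moreover have "Q (axis j 1) x = x $ j / complex_of_real (\<alpha> j)" for j
  proof -
    have "Q (axis j 1) x = (\<Sum>k\<in>UNIV. if k = j then x $ j / complex_of_real (\<alpha> j) else 0)"
      unfolding Q_def by (rule sum.cong) (auto simp: axis_def)
    then show ?thesis by simp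
  qed
  ultimately show ?thesis
    using \<alpha>_nz by (simp add: vec_eq_iff)
qed

text \<open>\<open>Q x x\<close> is real, hence so is \<open>E (h z) x x\<close>. Its imaginary part
  is \<open>Im (z^2)\<close> times a nonnegative integral; off the imaginary axis that integral must
  vanish, and with it \<open>W x\<close>.\<close>

lemma kernel_vector_Re_eq_0:
  assumes x: "kernel_vector z x" and z: "Im z > 0" and nz: "x \<noteq> 0"
  shows "Re z = 0"
proof (rule ccontr)
  assume Re: "Re z \<noteq> 0"
  have hm [measurable]: "(\<lambda>t. (cmod (h z t))\<^sup>2) \<in> borel_measurable borel" by measurable
  have hb: "\<bar>(cmod (h z t))\<^sup>2\<bar> \<le> (1 / (Im z)\<^sup>2)\<^sup>2" for t
    using norm_h_le[of z t] z by (simp only: abs_power2) (rule power_mono, auto)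
  have nz': "(complex_of_real t)\<^sup>2 - z\<^sup>2 \<noteq> 0" for t
    using z Re by (auto simp: complex_eq_iff power2_eq_square)
  \<comment> \<open>Twice the imaginary part of \<open>h z t\<close>, times \<open>\<i>\<close>,
    written as a linear combination to fit \<open>E_linear_h\<close>.\<close>
  have diff: "1 * h z t + (- 1) * cnj (h z t) = (z\<^sup>2 - cnj (z\<^sup>2)) * complex_of_real ((cmod (h z t))\<^sup>2)" for t
  proof -
    have "cnj ((complex_of_real t)\<^sup>2 - z\<^sup>2) \<noteq> 0" using nz'[of t] complex_cnj_zero_iff by blast
    then show ?thesis
      using nz'[of t] unfolding complex_norm_square h_def
      by (simp add: divide_simps)
  qed
  have "E (h z) x x = cnj (E (h z) x x)"
  proof -
    have "E (h z) x x = - complex_of_real (4 * pi) * Q x x" using x by (simp add: kernel_vector_def)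
    then show ?thesis by (simp add: Q_self)
  qed
  then have "0 = 1 * E (h z) x x + (- 1) * E (\<lambda>t. cnj (h z t)) x x"
    by (simp add: E_cnj)
  also have "\<dots> = E (\<lambda>t. 1 * h z t + (- 1) * cnj (h z t)) x x"
    by (rule E_linear_h[symmetric]) (use norm_h_le[of z] z in auto)
  also have "\<dots> = (z\<^sup>2 - cnj (z\<^sup>2)) * E (\<lambda>t. complex_of_real ((cmod (h z t))\<^sup>2)) x x"
    unfolding diff E_def by (simp only: mult.left_commute[of _ "z\<^sup>2 - cnj (z\<^sup>2)"] integral_mult_right_zero)
  also have "\<dots> = (z\<^sup>2 - cnj (z\<^sup>2)) * complex_of_real (LINT t|lborel. (cmod (W x t))\<^sup>2 * (cmod (h z t))\<^sup>2)"
    by (subst E_diagonal(1)[OF hm hb]) (rule refl)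
  \<comment> \<open>\<open>z^2 - cnj (z^2)\<close> equals \<open>4 * \<i> * Re z * Im z\<close>,
    which is nonzero here.\<close>
  finally have "(LINT t|lborel. (cmod (W x t))\<^sup>2 * (cmod (h z t))\<^sup>2) = 0"
    using Re z by (auto simp: complex_eq_iff power2_eq_square)
  then have "AE t in lborel. W x t = 0"
    by (rule AE_W_eq_0[OF hm hb, rotated]) (use nz' in \<open>auto simp: h_def\<close>)
  then show False
    using kernel_vector_eq_0[OF x] nz by simp
qed

section \<open>Negativity of \<open>Q\<close> on sums of kernel vectors at points of the imaginary
  axis\<close>

definition r :: "complex \<Rightarrow> real \<Rightarrow> real" where
  "r z t = 1 / (t\<^sup>2 + (Im z)\<^sup>2)"

lemma r_meas [measurable]: "r z \<in> borel_measurable borel"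
  unfolding r_def by measurable

lemma h_eq_r: "Re z = 0 \<Longrightarrow> h z t = complex_of_real (r z t)"
proof -
  assume "Re z = 0"
  then have "z\<^sup>2 = - complex_of_real ((Im z)\<^sup>2)"
    by (simp add: complex_eq_iff power2_eq_square)
  then show ?thesis by (simp add: h_def r_def)
qed

lemma r_pos: "Im z \<noteq> 0 \<Longrightarrow> r z t > 0"
  by (simp add: r_def add_nonneg_pos)

lemma r_le: "Im z \<noteq> 0 \<Longrightarrow> r z t \<le> 1 / (Im z)\<^sup>2"
  by (simp add: r_def frac_le)

text \<open>Keeps the weights with an extra factor \<open>t^2\<close> bounded, so that their forms
  are integrable.\<close>

lemma r_power2_le: "Im z \<noteq> 0 \<Longrightarrow> t\<^sup>2 * r z t \<le> 1"
  using add_nonneg_pos[of "t\<^sup>2" "(Im z)\<^sup>2"] by (simp add: r_def divide_le_eq)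

text \<open>\<open>- 4 * pi * Q\<close> at the sum is a sum of nonnegative terms, so
  \<open>Q \<ge> 0\<close> forces all of them to vanish. One statement serves two purposes: it
  applies when the sum is zero, and also when the sum vanishes in all coordinates with negative
  \<open>\<alpha>\<close>.\<close>

lemma kernel_vectors_negative:
  assumes F: "finite F" and im: "\<And>z. z \<in> F \<Longrightarrow> Re z = 0 \<and> Im z > 0"
    and x: "\<And>z. z \<in> F \<Longrightarrow> kernel_vector z (x z)"
    and pos: "Re (Q (\<Sum>z\<in>F. x z) (\<Sum>z\<in>F. x z)) \<ge> 0"
  shows "\<forall>z\<in>F. x z = 0"
proof -
  \<comment> \<open>With \<open>f p = r p * W (x p)\<close>, \<open>O2 q p\<close> is the inner
    product of \<open>f q\<close> and \<open>f p\<close>, \<open>T2 q p\<close> the same with weight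
    \<open>t^2\<close>, and \<open>N p\<close> the squared norm of \<open>f p\<close>.\<close>
  define O2 where "O2 q p = E (\<lambda>t. complex_of_real (r q t * r p t)) (x q) (x p)" for q p
  define T2 where "T2 q p = E (\<lambda>t. complex_of_real (t\<^sup>2 * (r q t * r p t))) (x q) (x p)" for q p
  define N where "N p = (LINT t|lborel. (cmod (W (x p) t))\<^sup>2 * (r p t * r p t))" for p
  have rr: "\<bar>r q t * r p t\<bar> \<le> 1 / (Im q)\<^sup>2 * (1 / (Im p)\<^sup>2)"
    and trr: "\<bar>t\<^sup>2 * (r q t * r p t)\<bar> \<le> 1 / (Im p)\<^sup>2" if "q \<in> F" "p \<in> F" for q p t
  proof -
    have nz: "Im q \<noteq> 0" "Im p \<noteq> 0" using im[OF that(1)] im[OF that(2)] by auto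
    note b = r_pos[OF nz(1), of t] r_pos[OF nz(2), of t] r_le[OF nz(1), of t] r_le[OF nz(2), of t]
    show "\<bar>r q t * r p t\<bar> \<le> 1 / (Im q)\<^sup>2 * (1 / (Im p)\<^sup>2)"
      unfolding abs_mult using b by (intro mult_mono) auto
    have "(t\<^sup>2 * r q t) * r p t \<le> 1 * (1 / (Im p)\<^sup>2)"
      using b r_power2_le[OF nz(1)] by (intro mult_mono) auto
    then show "\<bar>t\<^sup>2 * (r q t * r p t)\<bar> \<le> 1 / (Im p)\<^sup>2"
      using b by (simp add: abs_mult mult.assoc)
  qed
  have cnj_h: "(\<lambda>t. cnj (h z t)) = h z" if "z \<in> F" for z
    using im[OF that] by (simp add: h_eq_r fun_eq_iff)
  have Ep: "E (h p) (x q) (x p) = - complex_of_real (4 * pi) * Q (x q) (x p)" if "p \<in> F" for q p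
    using x[OF that] by (simp add: kernel_vector_def)
  \<comment> \<open>The kernel identity at \<open>q\<close> with test vector \<open>x p\<close>,
    conjugated. Together with \<open>Ep\<close> it shows that the weights \<open>h q\<close> and
    \<open>h p\<close> give the same value at \<open>x q\<close> and \<open>x p\<close>.\<close>
  have Eq: "E (h q) (x q) (x p) = - complex_of_real (4 * pi) * Q (x q) (x p)" if "q \<in> F" for q p
  proof -
    have "cnj (E (h q) (x p) (x q)) = - complex_of_real (4 * pi) * Q (x q) (x p)"
      unfolding Ep[OF that] by (simp add: Q_cnj)
    moreover have "cnj (E (h q) (x p) (x q)) = E (h q) (x q) (x p)"
      by (simp only: E_cnj cnj_h[OF that])
    ultimately show ?thesis by simp
  qed
  \<comment> \<open>From \<open>1 / (t\<^sup>2 + a) = t\<^sup>2 / ((t\<^sup>2 + a) (t\<^sup>2 + b)) + b / ((t\<^sup>2 + a) (t\<^sup>2 + b))\<close>. Exchanging the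
    two factors shows that the functions \<open>r p \<cdot> W (x p)\<close> are pairwise orthogonal.\<close>
  have h_split: "E (h q) (x q) (x p) = T2 q p + complex_of_real ((Im p)\<^sup>2) * O2 q p" if qp: "q \<in> F" "p \<in> F" for q p
  proof -
    have "h q t = 1 * complex_of_real (t\<^sup>2 * (r q t * r p t)) + complex_of_real ((Im p)\<^sup>2) * complex_of_real (r q t * r p t)" for t
    proof -
      have "t\<^sup>2 + (Im p)\<^sup>2 \<noteq> 0" using im[OF qp(2)] by (simp add: add_nonneg_eq_0_iff)
      then have "(t\<^sup>2 + (Im p)\<^sup>2) * r p t = 1"
        by (simp add: r_def)
      moreover have "t\<^sup>2 * (r q t * r p t) + (Im p)\<^sup>2 * (r q t * r p t) = r q t * ((t\<^sup>2 + (Im p)\<^sup>2) * r p t)"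
        by (simp add: algebra_simps)
      ultimately have "r q t = t\<^sup>2 * (r q t * r p t) + (Im p)\<^sup>2 * (r q t * r p t)"
        by simp
      then have "h q t = complex_of_real (t\<^sup>2 * (r q t * r p t) + (Im p)\<^sup>2 * (r q t * r p t))"
        using im[OF qp(1)] by (simp add: h_eq_r)
      then show ?thesis by simp
    qed
    then have "E (h q) (x q) (x p) = E (\<lambda>t. 1 * complex_of_real (t\<^sup>2 * (r q t * r p t))
        + complex_of_real ((Im p)\<^sup>2) * complex_of_real (r q t * r p t)) (x q) (x p)"
      by presburger
    also have "\<dots> = 1 * T2 q p + complex_of_real ((Im p)\<^sup>2) * O2 q p"
      unfolding T2_def O2_def
    proof (rule E_linear_h)
      show "cmod (complex_of_real (t\<^sup>2 * (r q t * r p t))) \<le> 1 / (Im p)\<^sup>2" for t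
        unfolding norm_of_real by (rule trr[OF qp])
      show "cmod (complex_of_real (r q t * r p t)) \<le> 1 / (Im q)\<^sup>2 * (1 / (Im p)\<^sup>2)" for t
        unfolding norm_of_real by (rule rr[OF qp])
    qed measurable
    finally show ?thesis by simp
  qed
  have T2_swap: "cnj (T2 p q) = T2 q p" and O2_swap: "cnj (O2 p q) = O2 q p" for p q
    unfolding T2_def O2_def E_cnj by (simp_all add: mult.commute)
  have h_split': "E (h p) (x q) (x p) = T2 q p + complex_of_real ((Im q)\<^sup>2) * O2 q p" if qp: "q \<in> F" "p \<in> F" for q p
  proof -
    have "E (h p) (x q) (x p) = cnj (E (h p) (x p) (x q))"
      by (simp only: E_cnj cnj_h[OF qp(2)])
    then show ?thesis
      unfolding h_split[OF qp(2,1)] by (simp add: T2_swap O2_swap)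
  qed
  have O2: "O2 q p = (if q = p then complex_of_real (N p) else 0)" if qp: "q \<in> F" "p \<in> F" for q p
  proof (cases "q = p")
    case True
    then show ?thesis
      unfolding O2_def N_def using E_diagonal(1)[of "\<lambda>t. r p t * r p t", OF _ rr[OF qp(2) qp(2)]] by simp
  next
    case False
    \<comment> \<open>The two splittings have equal left sides and share the term
      \<open>T2 q p\<close>, which cancels.\<close>
    have "complex_of_real ((Im p)\<^sup>2) * O2 q p = complex_of_real ((Im q)\<^sup>2) * O2 q p"
      using h_split[OF qp] h_split'[OF qp] Ep[OF qp(2), of q] Eq[OF qp(1), of p] by simp
    moreover have "(Im p)\<^sup>2 \<noteq> (Im q)\<^sup>2"
      using im[OF qp(1)] im[OF qp(2)] False by (auto simp: complex_eq_iff power2_eq_iff)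
    ultimately show ?thesis using False by (simp del: of_real_power)
  qed
  have N: "N p \<ge> 0" if "p \<in> F" for p
    unfolding N_def by (rule Bochner_Integration.integral_nonneg) simp
  \<comment> \<open>The sum of all \<open>f p\<close>: summing \<open>T2\<close> over all pairs
    expands the squared modulus of \<open>g\<close>.\<close>
  define g where "g t = (\<Sum>p\<in>F. complex_of_real (r p t) * W (x p) t)" for t
  have T2: "(\<Sum>q\<in>F. \<Sum>p\<in>F. T2 q p) = complex_of_real (LINT t|lborel. t\<^sup>2 * (cmod (g t))\<^sup>2)"
  proof -
    have "(\<Sum>q\<in>F. \<Sum>p\<in>F. T2 q p) = (LINT t|lborel. (\<Sum>q\<in>F. \<Sum>p\<in>F.
        cnj (W (x q) t) * W (x p) t * complex_of_real (t\<^sup>2 * (r q t * r p t))))"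
    proof -
      have *: "integrable lborel (\<lambda>t. cnj (W (x q) t) * W (x p) t * complex_of_real (t\<^sup>2 * (r q t * r p t)))"
        if "q \<in> F" "p \<in> F" for q p
      proof (rule integrable_bounded_mult[OF integrable_WW])
        show "cmod (complex_of_real (t\<^sup>2 * (r q t * r p t))) \<le> 1 / (Im p)\<^sup>2" for t
          unfolding norm_of_real by (rule trr[OF that])
      qed measurable
      show ?thesis
        unfolding T2_def E_def
        by (subst Bochner_Integration.integral_sum, (intro Bochner_Integration.integrable_sum *; assumption),
            intro sum.cong refl Bochner_Integration.integral_sum[symmetric] *; assumption)
    qed
    also have "\<dots> = (LINT t|lborel. complex_of_real (t\<^sup>2 * (cmod (g t))\<^sup>2))"
    proof (rule Bochner_Integration.integral_cong[OF refl])
      fix t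
      have "complex_of_real (t\<^sup>2 * (cmod (g t))\<^sup>2) = complex_of_real (t\<^sup>2) * (cnj (g t) * g t)"
        unfolding of_real_mult complex_norm_square by (simp add: mult_ac)
      also have "\<dots> = (\<Sum>q\<in>F. \<Sum>p\<in>F. cnj (W (x q) t) * W (x p) t * complex_of_real (t\<^sup>2 * (r q t * r p t)))"
        unfolding g_def cnj_sum sum_product unfolding sum_distrib_left
        by (intro sum.cong refl) (simp add: mult_ac)
      finally show "(\<Sum>q\<in>F. \<Sum>p\<in>F. cnj (W (x q) t) * W (x p) t * complex_of_real (t\<^sup>2 * (r q t * r p t)))
          = complex_of_real (t\<^sup>2 * (cmod (g t))\<^sup>2)" by simp
    qed
    finally show ?thesis by (simp only: integral_complex_of_real)
  qed
  \<comment> \<open>Sum the splitting over all pairs; orthogonality leaves only the diagonal of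
    \<open>O2\<close>.\<close>
  have "- complex_of_real (4 * pi) * Q (\<Sum>z\<in>F. x z) (\<Sum>z\<in>F. x z)
      = (\<Sum>q\<in>F. \<Sum>p\<in>F. T2 q p + complex_of_real ((Im p)\<^sup>2) * O2 q p)"
    unfolding Q_sum sum_distrib_left using Eq h_split by (intro sum.cong refl) simp
  also have "\<dots> = (\<Sum>q\<in>F. \<Sum>p\<in>F. T2 q p) + (\<Sum>q\<in>F. \<Sum>p\<in>F. if q = p then complex_of_real ((Im p)\<^sup>2 * N p) else 0)"
    unfolding sum.distrib by (intro arg_cong2[where f="(+)"] refl sum.cong) (simp add: O2)
  also have "(\<Sum>q\<in>F. \<Sum>p\<in>F. if q = p then complex_of_real ((Im p)\<^sup>2 * N p) else 0)
      = (\<Sum>p\<in>F. complex_of_real ((Im p)\<^sup>2 * N p))"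
    using F by simp
  finally have "- complex_of_real (4 * pi) * Q (\<Sum>z\<in>F. x z) (\<Sum>z\<in>F. x z)
      = complex_of_real ((LINT t|lborel. t\<^sup>2 * (cmod (g t))\<^sup>2) + (\<Sum>p\<in>F. (Im p)\<^sup>2 * N p))"
    by (simp only: T2 of_real_sum of_real_add)
  then have "- (4 * pi) * Re (Q (\<Sum>z\<in>F. x z) (\<Sum>z\<in>F. x z))
      = (LINT t|lborel. t\<^sup>2 * (cmod (g t))\<^sup>2) + (\<Sum>p\<in>F. (Im p)\<^sup>2 * N p)"
    by (auto dest!: arg_cong[where f=Re])
  moreover have "(LINT t|lborel. t\<^sup>2 * (cmod (g t))\<^sup>2) \<ge> 0"
    by (rule Bochner_Integration.integral_nonneg) simp
  moreover have "- (4 * pi) * Re (Q (\<Sum>z\<in>F. x z) (\<Sum>z\<in>F. x z)) \<le> 0"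
    using pos by (simp add: mult_nonneg_nonneg)
  moreover have Np: "(Im p)\<^sup>2 * N p \<ge> 0" if "p \<in> F" for p
    using N[OF that] by simp
  moreover have "(\<Sum>p\<in>F. (Im p)\<^sup>2 * N p) \<ge> 0"
    by (rule sum_nonneg) (rule Np)
  ultimately have "(\<Sum>p\<in>F. (Im p)\<^sup>2 * N p) = 0"
    by linarith
  then have N0: "N p = 0" if "p \<in> F" for p
    using sum_nonneg_eq_0_iff[OF F Np] im[OF that] that by auto
  show ?thesis
  proof
    fix p assume p: "p \<in> F"
    \<comment> \<open>\<open>N p = 0\<close> is the vanishing of an integral with the strictly
      positive weight \<open>r p t * r p t\<close>.\<close>
    have "AE t in lborel. W (x p) t = 0"
      by (rule AE_W_eq_0[OF _ rr[OF p p]]) (use N0[OF p] im[OF p] in \<open>auto simp: N_def r_pos\<close>)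
    then show "x p = 0" by (rule kernel_vector_eq_0[OF x[OF p]])
  qed
qed

end

section \<open>Roots of the determinant\<close>

lemma odd_L2_family_w_fun:
  fixes \<alpha> :: "'n::finite \<Rightarrow> real" and v :: "'n \<Rightarrow> real \<Rightarrow> complex"
  assumes "\<And>k. \<alpha> k \<noteq> 0" and v: "\<And>k. weighted_L2 (v k)"
  shows "odd_L2_family (w_fun v) \<alpha>"
  by unfold_locales (use assms(1) weighted_L2_w_fun[OF v] in \<open>auto simp: w_fun_def\<close>)

text \<open>The passage from the matrix to the forms: products of two odd functions are even, so
  each Cauchy integral symmetrizes and the entries of the matrix share the nonzero factor
  \<open>c\<close>.\<close>

lemma kernel_vector_if_kernel:
  fixes \<alpha> :: "'n::finite \<Rightarrow> real" and v :: "'n \<Rightarrow> real \<Rightarrow> complex"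
  assumes \<alpha>: "\<And>k. \<alpha> k \<noteq> 0" and v: "\<And>k. weighted_L2 (v k)"
    and z: "Im z > 0" and 0: "A_mat \<alpha> v z *v x = 0"
  shows "odd_L2_family.kernel_vector (w_fun v) \<alpha> z x"
proof -
  interpret odd_L2_family "w_fun v" \<alpha> by (rule odd_L2_family_w_fun[OF \<alpha> v])
  \<comment> \<open>This is \<open>z / (2 * pi * \<i>)\<close>, the prefactor of the Cauchy integral
    times the \<open>z\<close> from symmetrization.\<close>
  define c where "c = - \<i> * z / (2 * complex_of_real pi)"
  have c: "c \<noteq> 0" using z by (auto simp: c_def)
  define I where "I j k = (LINT t|lborel. cnj (w_fun v j t) * w_fun v k t * h z t)" for j k
  \<comment> \<open>Chosen so that \<open>c * d j\<close> is the diagonal term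
    \<open>- 2 * \<i> * z / \<alpha> j\<close>.\<close>
  define d where "d j = complex_of_real (4 * pi) / complex_of_real (\<alpha> j)" for j
  have A: "A_mat \<alpha> v z $ j $ k = c * (I j k + (if j = k then d j else 0))" for j k
  proof -
    have "(LINT t|lebesgue. (WW v t $ j $ k) / (complex_of_real t - z))
        = (LINT t|lborel. cnj (w_fun v j t) * w_fun v k t / (complex_of_real t - z))"
      unfolding WW_def vec_lambda_beta by (rule integral_completion) measurable
    also have "\<dots> = z * I j k"
      using cauchy_integral_even[OF integrable_ww[of j k], of z] z by (simp add: w_odd h_def I_def)
    finally have "A_mat \<alpha> v z $ j $ k = 1 / (2 * complex_of_real pi * \<i>) * (z * I j k)
        - 2 * \<i> * z * (if j = k then complex_of_real (1 / \<alpha> j) else 0)"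
      unfolding A_mat_def vec_lambda_beta matrix_inv_diag_mat[OF \<alpha>]
      by (simp only: diag_mat_def vec_lambda_beta)
    moreover have "1 / (2 * complex_of_real pi * \<i>) * (z * I j k) = c * I j k"
      by (simp add: c_def field_simps)
    moreover have "2 * \<i> * z * complex_of_real (1 / \<alpha> i) = - (c * d i)" for i
      by (simp add: c_def d_def)
    ultimately show ?thesis
      by (cases "j = k") (simp_all only: if_True if_False distrib_left diff_minus_eq_add mult_zero_right diff_zero add_0_right simp_thms)
  qed
  have ww: "integrable lborel (\<lambda>t. cnj (w_fun v j t) * w_fun v k t * h z t)" for j k
    by (rule integrable_bounded_mult[OF integrable_ww h_meas norm_h_le]) (use z in simp)
  show "kernel_vector z x"
    unfolding kernel_vector_def
  proof
    fix y
    \<comment> \<open>Pair the kernel equation with \<open>y\<close>, collect the two forms, then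
      cancel \<open>c\<close>.\<close>
    have "0 = (\<Sum>j\<in>UNIV. cnj (y $ j) * (A_mat \<alpha> v z *v x) $ j)"
      unfolding 0 by simp
    also have "\<dots> = (\<Sum>j\<in>UNIV. \<Sum>k\<in>UNIV. c * (cnj (y $ j) * x $ k * I j k)
         + (if j = k then c * (cnj (y $ j) * x $ j * d j) else 0))"
      unfolding matrix_vector_mult_def vec_lambda_beta sum_distrib_left A
      by (intro sum.cong refl) (simp add: distrib_left distrib_right mult_ac)
    also have "\<dots> = c * (\<Sum>j\<in>UNIV. \<Sum>k\<in>UNIV. cnj (y $ j) * x $ k * I j k)
         + c * (\<Sum>j\<in>UNIV. cnj (y $ j) * x $ j * d j)"
      by (simp add: sum.distrib sum_distrib_left)
    also have "(\<Sum>j\<in>UNIV. cnj (y $ j) * x $ j * d j) = complex_of_real (4 * pi) * Q y x"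
      unfolding Q_def sum_distrib_left by (rule sum.cong) (simp_all add: d_def)
    also have "(\<Sum>j\<in>UNIV. \<Sum>k\<in>UNIV. cnj (y $ j) * x $ k * I j k) = E (h z) y x"
    proof -
      have "E (h z) y x = (LINT t|lborel. (\<Sum>j\<in>UNIV. \<Sum>k\<in>UNIV. cnj (y $ j) * x $ k * (cnj (w_fun v j t) * w_fun v k t * h z t)))"
        unfolding E_def WW_expand sum_distrib_right by (simp only: mult.assoc)
      also have "\<dots> = (\<Sum>j\<in>UNIV. LINT t|lborel. (\<Sum>k\<in>UNIV. cnj (y $ j) * x $ k * (cnj (w_fun v j t) * w_fun v k t * h z t)))"
        by (intro Bochner_Integration.integral_sum Bochner_Integration.integrable_sum integrable_mult_right ww)
      also have "\<dots> = (\<Sum>j\<in>UNIV. \<Sum>k\<in>UNIV. LINT t|lborel. cnj (y $ j) * x $ k * (cnj (w_fun v j t) * w_fun v k t * h z t))"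
        by (intro sum.cong refl Bochner_Integration.integral_sum integrable_mult_right ww)
      finally show ?thesis by (simp only: integral_mult_right_zero I_def)
    qed
    finally have "c * (E (h z) y x + complex_of_real (4 * pi) * Q y x) = 0"
      by (simp only: distrib_left)
    then show "E (h z) y x = - complex_of_real (4 * pi) * Q y x"
      using c by (simp only: mult_eq_0_iff simp_thms add_eq_0_iff2 mult_minus_left)
  qed
qed

theorem theorem2p1:
  fixes \<alpha> :: "'n::finite \<Rightarrow> real" and v :: "'n \<Rightarrow> real \<Rightarrow> complex"
  assumes alpha_nz: "\<And>k. \<alpha> k \<noteq> 0"
    and v_L2: "\<And>k. weighted_L2 (v k)"
  shows "(n_minus \<alpha> = 0 \<longrightarrow> (\<forall>z\<in>upper_half_plane. a_fun \<alpha> v z \<noteq> 0)) \<and>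
    (n_minus \<alpha> > 0 \<and> lin_indep_L2 v \<longrightarrow>
       finite (roots_up \<alpha> v) \<and>
       (\<forall>z\<in>roots_up \<alpha> v. \<exists>\<kappa>::real. \<kappa> > 0 \<and> z = \<i> * complex_of_real \<kappa>) \<and>
       (\<forall>z\<in>roots_up \<alpha> v. \<forall>z'\<in>roots_up \<alpha> v. z \<noteq> z' \<longrightarrow>
          ker_mat (A_mat \<alpha> v z) \<inter> ker_mat (A_mat \<alpha> v z') = {0}) \<and>
       (\<Sum>z\<in>roots_up \<alpha> v. vec.dim (ker_mat (A_mat \<alpha> v z))) \<le> n_minus \<alpha>)"
proof -
  interpret odd_L2_family "w_fun v" \<alpha>
    by (rule odd_L2_family_w_fun) fact+
  define K where "K z = ker_mat (A_mat \<alpha> v z)" for z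
  define R where "R = roots_up \<alpha> v"
  have K_sub: "vec.subspace (K z)" for z
    by (auto simp: K_def ker_mat_def vec.subspace_def matrix_vector_right_distrib matrix_vector_mult_scaleR
        vec.scale vec.linear_scale)
  have root: "\<exists>x. x \<noteq> 0 \<and> x \<in> K z" if "z \<in> R" for z
    using that det_eq_0_iff_kernel[of "A_mat \<alpha> v z"] by (auto simp: R_def roots_up_def a_fun_def K_def ker_mat_def)
  have kv: "kernel_vector z x" if "z \<in> R" "x \<in> K z" for z x
    using that kernel_vector_if_kernel[OF alpha_nz v_L2]
    by (auto simp: R_def roots_up_def upper_half_plane_def K_def ker_mat_def)
  have im: "Re z = 0 \<and> Im z > 0" if z: "z \<in> R" for z
  proof -
    obtain x where "x \<noteq> 0" "x \<in> K z" using root[OF z] by blast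
    moreover have "Im z > 0" using z by (simp add: R_def roots_up_def upper_half_plane_def)
    ultimately show ?thesis using kernel_vector_Re_eq_0[OF kv[OF z]] by blast
  qed
  \<comment> \<open>Stated for finite subsets, because finiteness of \<open>R\<close> is itself
    deduced from this bound.\<close>
  have bound: "(\<Sum>z\<in>F. vec.dim (K z)) \<le> n_minus \<alpha>" if F: "finite F" "F \<subseteq> R" for F
    unfolding n_minus_def
  proof (rule sum_dim_le_card_coordinates[OF F(1) K_sub])
    fix x assume x: "\<And>z. z \<in> F \<Longrightarrow> x z \<in> K z" and 0: "\<forall>k\<in>{k. \<alpha> k < 0}. (\<Sum>z\<in>F. x z) $ k = 0"
    show "\<forall>z\<in>F. x z = 0"
    proof (rule kernel_vectors_negative[OF F(1)])
      \<comment> \<open>The coordinates with negative \<open>\<alpha>\<close> are zero, so every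
        term of \<open>Q_self\<close> is nonnegative.\<close>
      have "(cmod ((\<Sum>z\<in>F. x z) $ j))\<^sup>2 / \<alpha> j \<ge> 0" for j
        using 0 by (cases "\<alpha> j < 0") auto
      then show "Re (Q (\<Sum>z\<in>F. x z) (\<Sum>z\<in>F. x z)) \<ge> 0"
        unfolding Q_self Re_complex_of_real by (intro sum_nonneg)
    qed (use im kv x F(2) in auto)
  qed
  have dim1: "vec.dim (K z) \<ge> 1" if "z \<in> R" for z
    using root[OF that] vec.dim_eq_0[of "K z"] by (metis One_nat_def Suc_leI neq0_conv singletonD subsetD)
  \<comment> \<open>Each root contributes dimension at least one, so no finite set of roots exceeds
    \<open>n_minus \<alpha>\<close> in size.\<close>
  have fin: "finite R \<and> card R \<le> n_minus \<alpha>"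
  proof (rule finite_if_finite_subsets_card_bdd)
    fix F assume F: "F \<subseteq> R" "finite F"
    have "card F \<le> (\<Sum>z\<in>F. vec.dim (K z))"
      using sum_mono[of F "\<lambda>_. 1" "\<lambda>z. vec.dim (K z)"] dim1 F(1) by auto
    then show "card F \<le> n_minus \<alpha>" using bound[OF F(2,1)] by simp
  qed
  have part1: "a_fun \<alpha> v z \<noteq> 0" if "n_minus \<alpha> = 0" "z \<in> upper_half_plane" for z
  proof
    assume "a_fun \<alpha> v z = 0"
    then have "z \<in> R" using that by (simp add: R_def roots_up_def)
    \<comment> \<open>With \<open>n_minus \<alpha> = 0\<close> the cardinality bound leaves
      \<open>R\<close> empty.\<close>
    then show False using fin that(1) by auto
  qed
  have part3: "K z \<inter> K z' = {0}" if z: "z \<in> R" "z' \<in> R" "z \<noteq> z'" for z z'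
  proof -
    have "u = 0" if u: "u \<in> K z" "u \<in> K z'" for u
    proof -
      \<comment> \<open>The family \<open>u\<close>, \<open>- u\<close> at the two roots sums to
        zero, so \<open>Q\<close> vanishes at its sum.\<close>
      define x where "x p = (if p = z then u else - u)" for p
      have "\<forall>p\<in>{z, z'}. x p = 0"
      proof (rule kernel_vectors_negative)
        show "kernel_vector p (x p)" if "p \<in> {z, z'}" for p
          using that z u vec.subspace_neg[OF K_sub] by (auto simp: x_def intro!: kv)
        have "(\<Sum>p\<in>{z, z'}. x p) = 0" using z(3) by (simp add: x_def)
        then show "Re (Q (\<Sum>p\<in>{z, z'}. x p) (\<Sum>p\<in>{z, z'}. x p)) \<ge> 0"
          by (simp add: Q_self)
      qed (use im z in auto)
      then show "u = 0" by (simp add: x_def)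
    qed
    then show ?thesis using vec.subspace_0[OF K_sub] by blast
  qed
  have part2: "\<exists>\<kappa>::real. \<kappa> > 0 \<and> z = \<i> * complex_of_real \<kappa>" if "z \<in> R" for z
    using im[OF that] by (intro exI[of _ "Im z"]) (simp add: complex_eq_iff)
  show ?thesis
    using part1 part2 part3 fin bound[of R] unfolding R_def K_def by blast
qed

end
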